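(* Let $d>3$. There exists a function $c_d'\colon(0,1)\to(0,\infty)$ such that the following holds. Let $0<\varepsilon<1$. For any (deterministic) sequence $(A_n)_{n\in\mathbb N}$ of real $d\times d$ matrices with $\|A_n\|\le 1$ for all $n$, the random variable $$\liminf_{n\to\infty}\frac 1n\log\frac{s_1(A_\varepsilon^{(n)})}{s_d(A_\varepsilon^{(n)})}$$ is almost surely constant, and the constant is at least $c_d'(\varepsilon)$. Further, $c_d'(\varepsilon)>\exp(-1/\varepsilon^{16d+3})$ for all sufficiently small $\varepsilon>0$.
   Context: $\|M\|$ is the operator norm of a matrix $M$ induced by the Euclidean norm, and $s_1(M)\ge\dots\ge s_d(M)$ are the singular values of a $d\times d$ matrix $M$. $(\Xi_n)_{n\in\mathbb N}$ is a sequence of independent random $d\times d$ matrices, each with mutually independent entries uniformly distributed on $[-1,1]$. Given a fixed sequence $(A_n)$, set $A_{n,\varepsilon}=A_n+\varepsilon\Xi_n$ and $A_\varepsilon^{(n)}=A_{n,\varepsilon}A_{n-1,\varepsilon}\cdots A_{1,\varepsilon}$. "Almost surely" refers to the randomness of $(\Xi_n)$. The quantity $c_d'(\varepsilon)$ does not depend on the sequence $(A_n)$. *)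

theory Defs
  imports "HOL-Probability.Probability" "HOL-Computational_Algebra.Computational_Algebra"
begin

definition charpoly :: "real ^ 'n ^ 'n \<Rightarrow> real poly" where
  "charpoly M = det (mat [:0, 1:] - map_matrix (\<lambda>x. [:x:]) M)"

(* Square roots of the eigenvalues of the Gram matrix (all real and nonnegative), with algebraic
   multiplicity, in nonincreasing order; the list has length CARD('n). *)
definition singular_values :: "real ^ 'n ^ 'n \<Rightarrow> real list" where
  "singular_values M =
     rev (sorted_list_of_multiset (image_mset sqrt (proots (charpoly (transpose M ** M)))))"

(* Numbered from 1: singular_value 1 is the largest, singular_value CARD('n) the smallest. *)
definition singular_value :: "nat \<Rightarrow> real ^ 'n ^ 'n \<Rightarrow> real" where
  "singular_value k M = singular_values M ! (k - 1)"

(* Sequences are indexed by the positive integers; the value at 0 is unconstrained and unused. *)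
definition iid_uniform_matrices :: "'w measure \<Rightarrow> (nat \<Rightarrow> 'w \<Rightarrow> real ^ 'n ^ 'n) \<Rightarrow> bool" where
  "iid_uniform_matrices P \<Xi> \<longleftrightarrow>
     prob_space P \<and>
     prob_space.indep_vars P (\<lambda>_. borel) \<Xi> {1..} \<and>
     (\<forall>n\<ge>1. prob_space.indep_vars P (\<lambda>_. borel) (\<lambda>(i, j) \<omega>. \<Xi> n \<omega> $ i $ j) UNIV \<and>
       (\<forall>i j. distr P borel (\<lambda>\<omega>. \<Xi> n \<omega> $ i $ j) = uniform_measure lborel {-1..1}))"

primrec matrix_product :: "(nat \<Rightarrow> real ^ 'n ^ 'n) \<Rightarrow> nat \<Rightarrow> real ^ 'n ^ 'n" where
  "matrix_product B 0 = mat 1"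
| "matrix_product B (Suc n) = B (Suc n) ** matrix_product B n"

definition perturbed_product ::
  "(nat \<Rightarrow> real ^ 'n ^ 'n) \<Rightarrow> real \<Rightarrow> (nat \<Rightarrow> real ^ 'n ^ 'n) \<Rightarrow> nat \<Rightarrow> real ^ 'n ^ 'n" where
  "perturbed_product A \<epsilon> X = matrix_product (\<lambda>k. A k + \<epsilon> *\<^sub>R X k)"

end

theory Submission
  imports Defs "HOL-Real_Asymp.Real_Asymp"
begin

text \<open>
Write \<open>g\<^sub>k = A\<^sub>k + \<epsilon> \<Xi>\<^sub>k\<close>, let \<open>M\<^sub>n = g\<^sub>n \<cdots> g\<^sub>1\<close>, and let \<open>d\<close> be the dimension. For a nonnegative
function \<open>F\<close> on \<open>d\<close>-space that is homogeneous of degree \<open>- d / 2\<close>, put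
\<open>(P\<^sub>k F) x = E (sqrt \<bar>det g\<^sub>k\<bar> * F (g\<^sub>k x))\<close>. Such functions are functions on the space of directions.
Measured by the integral of \<open>F\<^sup>2\<close> over a fundamental domain of the dilation by \<open>2\<close>, their norm does
not change when \<open>F\<close> is replaced by \<open>x \<mapsto> sqrt \<bar>det g\<bar> * F (g x)\<close> with \<open>g\<close> invertible: this is the change of
variables on the sphere (\<open>shell_integral_invariant\<close>). Hence each \<open>P\<^sub>k\<close> is an average of isometries.

The heart of the proof is that \<open>P\<^sub>k\<close> contracts by a factor that does not depend on \<open>A\<^sub>k\<close>
(\<open>equivariant_mean_square\<close>, \<open>mean_operator_contraction\<close>). Fix \<open>x\<close>. The function
\<open>H g = sqrt \<bar>det g\<bar> * F (g x)\<close> satisfies \<open>H (g R) = sqrt \<bar>det R\<bar> * H g\<close> whenever \<open>R x = x\<close>. Let \<open>R\<close>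
stretch by \<open>1 + s\<close> in a direction orthogonal to \<open>x\<close>, with \<open>s = \<epsilon> / (d + 2)\<close>. The noise
is spread over a cube, so many values of \<open>g\<close> and of \<open>g R\<close> are both attained, and \<open>H\<close> differs between
them by a fixed factor. So \<open>H\<close> is far from constant, and \<open>(E H)\<^sup>2 \<le> E (H\<^sup>2)\<close> is strict by a definite
amount of order \<open>s\<^sup>2\<close> (\<open>orthogonality_defect\<close>).

By independence \<open>E (sqrt \<bar>det M\<^sub>n\<bar> * F (M\<^sub>n x)) = (P\<^sub>1 \<cdots> P\<^sub>n F) x\<close>, and the contraction factors
multiply. With \<open>F x = norm x powr (- d / 2)\<close> this shows that the mean of
\<open>sqrt \<bar>det M\<^sub>n\<bar> * norm M\<^sub>n powr (- d / 2)\<close> decays exponentially, hence so does this quantity almost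
surely. It is bounded below by a constant times \<open>(s\<^sub>d / s\<^sub>1) powr ((d - 1) / 2)\<close>, which gives an
exponential lower bound for \<open>s\<^sub>1 / s\<^sub>d\<close>. The resulting rate is a constant times \<open>\<epsilon>\<^sup>2\<close>, and a constant times
\<open>\<epsilon>\<^sup>2\<close> exceeds the required \<open>exp (- 1 / \<epsilon> ^ (16 * d + 3))\<close> for small \<open>\<epsilon>\<close>.

The limit inferior is constant by Kolmogorov's zero-one law: almost surely all factors are
invertible, and then removing finitely many of them changes \<open>ln (s\<^sub>1 / s\<^sub>d)\<close> by a bounded amount
(\<open>condition_number_mult\<close>).
\<close>

(* The dollar sign denotes components of vectors, not coefficients of power series. *)
unbundle no fps_syntax

section \<open>Eigenbases and extreme singular values\<close>

lemma symmetric_dot: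
  fixes S :: "real^'n^'n"
  assumes "transpose S = S"
  shows "x \<bullet> (S *v y) = (S *v x) \<bullet> y"
  by (metis assms dot_lmul_matrix matrix_vector_mul_assoc transpose_matrix_vector inner_commute)

text \<open>
A maximiser of the quadratic form \<open>w \<bullet> S w\<close> on the unit sphere of an invariant subspace is an
eigenvector: the first-order condition is tested in the direction of the defect
\<open>z = S v - l v\<close>, which itself lies in the subspace.
\<close>

lemma symmetric_eigenvector_in_subspace:
  fixes S :: "real^'n^'n"
  assumes S: "transpose S = S" and W: "subspace W" "\<And>w. w \<in> W \<Longrightarrow> S *v w \<in> W"
    and u: "u \<in> W" "u \<noteq> 0"
  obtains v l where "v \<in> W" "norm v = 1" "S *v v = l *\<^sub>R v"
proof -
  define f where "f = (\<lambda>w. w \<bullet> (S *v w))"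
  let ?K = "W \<inter> sphere 0 1"
  have "compact ?K"
    using closed_subspace[OF W(1)] compact_sphere by (metis closed_Int_compact)
  moreover have "(1 / norm u) *\<^sub>R u \<in> ?K"
    using u W(1) by (simp add: subspace_scale)
  moreover have "continuous_on ?K f"
    unfolding f_def by (intro continuous_intros matrix_vector_mult_linear_continuous_on)
  ultimately obtain v where v: "v \<in> ?K" and vmax: "\<And>w. w \<in> ?K \<Longrightarrow> f w \<le> f v"
    using continuous_attains_sup[of ?K f] by (metis empty_iff)
  define l where "l = f v"
  have hom: "f w \<le> l * (norm w)\<^sup>2" if "w \<in> W" for w
  proof (cases "w = 0")
    case False
    have "(1 / norm w) *\<^sub>R w \<in> ?K"
      using that False W(1) by (simp add: subspace_scale)
    from vmax[OF this] have "f ((1 / norm w) *\<^sub>R w) \<le> l"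
      by (simp add: l_def)
    then show ?thesis
      using False by (simp add: f_def matrix_vector_mult_scaleR power2_eq_square field_simps)
  qed (simp add: f_def)
  \<comment> \<open>Moving from \<open>v\<close> towards \<open>z\<close> would increase the Rayleigh quotient to first order.\<close>
  define z where "z = S *v v - l *\<^sub>R v"
  have zW: "z \<in> W"
    unfolding z_def using v W by (auto intro!: subspace_diff subspace_scale)
  define c where "c = f z - l * (norm z)\<^sup>2"
  have nv: "v \<bullet> v = 1"
    using v by (simp add: dot_square_norm)
  have zz: "z \<bullet> z = z \<bullet> (S *v v) - l * (z \<bullet> v)"
    by (simp add: z_def inner_diff_right)
  have quad: "2 * t * (z \<bullet> z) + t\<^sup>2 * c \<le> 0" for t
  proof -
    have "v + t *\<^sub>R z \<in> W"
      using v zW W(1) by (auto intro!: subspace_add subspace_scale)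
    from hom[OF this] have *: "f (v + t *\<^sub>R z) \<le> l * ((v + t *\<^sub>R z) \<bullet> (v + t *\<^sub>R z))"
      by (simp add: power2_norm_eq_inner)
    have "f (v + t *\<^sub>R z) = l + 2 * t * (z \<bullet> (S *v v)) + t\<^sup>2 * f z"
      using symmetric_dot[OF S, of v z]
      by (simp add: f_def l_def matrix_vector_right_distrib matrix_vector_mult_scaleR inner_simps
          power2_eq_square inner_commute algebra_simps)
    moreover have "(v + t *\<^sub>R z) \<bullet> (v + t *\<^sub>R z) = 1 + 2 * t * (z \<bullet> v) + t\<^sup>2 * (z \<bullet> z)"
      using nv by (simp add: inner_simps power2_eq_square inner_commute algebra_simps)
    ultimately have "l + 2 * t * (z \<bullet> (S *v v)) + t\<^sup>2 * f z \<le> l * (1 + 2 * t * (z \<bullet> v) + t\<^sup>2 * (z \<bullet> z))"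
      using * by simp
    moreover have "2 * t * (z \<bullet> z) = 2 * t * (z \<bullet> (S *v v)) - l * (2 * t * (z \<bullet> v))"
      by (simp add: zz algebra_simps)
    ultimately show ?thesis
      unfolding c_def power2_norm_eq_inner by (simp add: algebra_simps)
  qed
  have "z = 0"
  proof (rule ccontr)
    assume "z \<noteq> 0"
    then have p: "z \<bullet> z > 0" by simp
    define t where "t = (z \<bullet> z) / (\<bar>c\<bar> + 1)"
    have t: "t > 0" using p by (simp add: t_def)
    have "t * \<bar>c\<bar> < z \<bullet> z"
      using p by (simp add: t_def field_simps)
    moreover have "- (t * c) \<le> t * \<bar>c\<bar>"
      using t by (simp add: abs_if)
    ultimately have "0 < 2 * (z \<bullet> z) + t * c"
      using p by linarith
    then have "0 < t * (2 * (z \<bullet> z) + t * c)"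
      using t by simp
    with quad[of t] show False
      by (simp add: algebra_simps power2_eq_square)
  qed
  then show thesis
    using that v by (auto simp: z_def)
qed

text \<open>
The orthogonal complement of a set of eigenvectors is invariant, so as long as there are
fewer than \<open>CARD('n)\<close> of them the previous lemma supplies another one.
\<close>

lemma symmetric_orthonormal_eigenvectors:
  fixes S :: "real^'n^'n"
  assumes S: "transpose S = S" and k: "k \<le> CARD('n)"
  shows "\<exists>B. finite B \<and> card B = k \<and> pairwise orthogonal B \<and>
    (\<forall>b\<in>B. norm b = 1 \<and> (\<exists>l. S *v b = l *\<^sub>R b))"
  using k
proof (induction k)
  case 0
  show ?case by (rule exI[of _ "{}"]) (simp add: pairwise_def)
next
  case (Suc k)
  then obtain B where B: "finite B" "card B = k" "pairwise orthogonal B"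
    "\<forall>b\<in>B. norm b = 1 \<and> (\<exists>l. S *v b = l *\<^sub>R b)"
    by auto
  define W where "W = {w. \<forall>b\<in>B. b \<bullet> w = 0}"
  have "dim B < DIM(real^'n)"
    using dim_le_card'[OF B(1)] B(2) Suc.prems by simp
  from orthogonal_to_subspace_exists[OF this] obtain u where
    u: "u \<noteq> 0" "\<And>y. y \<in> span B \<Longrightarrow> orthogonal u y" by blast
  have uW: "u \<in> W"
    using u(2) by (auto simp: W_def orthogonal_def inner_commute span_base)
  have W: "subspace W"
    by (auto simp: subspace_def W_def inner_simps)
  have SW: "S *v w \<in> W" if "w \<in> W" for w
    unfolding W_def
  proof safe
    fix b assume b: "b \<in> B"
    then obtain l where "S *v b = l *\<^sub>R b" using B(4) by blast
    then show "b \<bullet> (S *v w) = 0"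
      using b that by (simp add: symmetric_dot[OF S] W_def)
  qed
  obtain v l where v: "v \<in> W" "norm v = 1" "S *v v = l *\<^sub>R v"
    using symmetric_eigenvector_in_subspace[OF S W SW uW u(1)] by metis
  have vB: "v \<notin> B"
  proof
    assume "v \<in> B"
    then have "v \<bullet> v = 0" using v(1) by (simp add: W_def)
    then show False using v(2) by simp
  qed
  show ?case
  proof (intro exI[of _ "insert v B"] conjI)
    show "pairwise orthogonal (insert v B)"
      using B(3) v(1) by (auto simp: pairwise_insert orthogonal_def W_def inner_commute)
  qed (use B v vB in auto)
qed

definition columns_matrix :: "('n \<Rightarrow> 'a ^ 'm) \<Rightarrow> 'a ^ 'n ^ 'm" where
  "columns_matrix b = (\<chi> i j. b j $ i)"

definition diagonal_matrix :: "('n \<Rightarrow> 'a::zero) \<Rightarrow> 'a ^ 'n ^ 'n" where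
  "diagonal_matrix l = (\<chi> i j. if i = j then l i else 0)"

theorem symmetric_spectral:
  fixes S :: "real^'n^'n"
  assumes S: "transpose S = S"
  obtains b :: "'n \<Rightarrow> real^'n" and l :: "'n \<Rightarrow> real"
  where "\<And>i. norm (b i) = 1" "orthogonal_matrix (columns_matrix b)" "\<And>i. S *v b i = l i *\<^sub>R b i"
proof -
  obtain B where B: "finite B" "card B = CARD('n)" "pairwise orthogonal B"
    "\<forall>b\<in>B. norm b = 1 \<and> (\<exists>l. S *v b = l *\<^sub>R b)"
    using symmetric_orthonormal_eigenvectors[OF S order_refl] by blast
  obtain b where b: "bij_betw b (UNIV :: 'n set) B"
    using finite_same_card_bij[OF finite_class.finite_UNIV B(1)] B(2) by metis
  have bB: "b i \<in> B" for i
    using b by (auto simp: bij_betw_def)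
  have "\<forall>i. \<exists>l. S *v b i = l *\<^sub>R b i"
    using bB B(4) by blast
  then obtain l where l: "S *v b i = l i *\<^sub>R b i" for i
    using choice[of "\<lambda>i l. S *v b i = l *\<^sub>R b i"] by blast
  have nb: "norm (b i) = 1" for i
    using bB B(4) by blast
  have orth: "orthogonal_matrix (columns_matrix b)"
    unfolding orthogonal_matrix_orthonormal_columns
  proof safe
    have col: "column i (columns_matrix b) = b i" for i
      by (simp add: column_def columns_matrix_def vec_eq_iff)
    show "norm (column i (columns_matrix b)) = 1" for i
      unfolding col using bB B(4) by blast
    show "orthogonal (column i (columns_matrix b)) (column j (columns_matrix b))" if "i \<noteq> j" for i j
    proof -
      have "b i \<noteq> b j" using b that by (auto simp: bij_betw_def inj_on_def)
      then show ?thesis unfolding col using bB B(3) by (auto simp: pairwise_def)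
    qed
  qed
  show thesis
    by (rule that[OF nb orth l])
qed

lemma poly_det:
  fixes M :: "'a::comm_ring_1 poly ^ 'n ^ 'n"
  shows "poly (det M) x = det (map_matrix (\<lambda>p. poly p x) M)"
proof -
  have "poly (of_int (sign p)) x = of_int (sign p)" for p :: "'n \<Rightarrow> 'n"
    by (simp add: sign_def)
  then show ?thesis
    unfolding det_def by (simp add: poly_sum poly_prod)
qed

text \<open>
Evaluating the characteristic polynomial at every real point turns statements about
determinants of matrices of polynomials into statements about real determinants.
\<close>

lemma poly_charpoly: "poly (charpoly M) x = det (mat x - M)"
  unfolding charpoly_def poly_det
  by (rule arg_cong[of _ _ det]) (simp add: vec_eq_iff mat_def)

text \<open>
Both formulas come from one similarity argument, applied to \<open>S\<close> and to \<open>x I - S\<close>.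
\<close>

lemma charpoly_diagonalized:
  fixes S :: "real^'n^'n"
  assumes b: "orthogonal_matrix (columns_matrix b)" and l: "\<And>i. S *v b i = l i *\<^sub>R b i"
  shows "charpoly S = (\<Prod>i\<in>UNIV. [:- l i, 1:])" "det S = (\<Prod>i\<in>UNIV. l i)"
proof -
  let ?P = "columns_matrix b"
  have inv: "det ?P \<noteq> 0"
    using det_orthogonal_matrix[OF b] by auto
  have dg: "det (diagonal_matrix f) = (\<Prod>i\<in>UNIV. f i)" for f :: "'n \<Rightarrow> real"
    by (subst det_diagonal) (auto simp: diagonal_matrix_def)
  have conj: "det T = (\<Prod>i\<in>UNIV. f i)" if T: "\<And>i. T *v b i = f i *\<^sub>R b i" for T :: "real^'n^'n" and f
  proof -
    have "T ** ?P = ?P ** diagonal_matrix f"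
      using T by (simp add: vec_eq_iff matrix_matrix_mult_def matrix_vector_mult_def columns_matrix_def
          diagonal_matrix_def if_distrib cong: if_cong)
    then have "det T * det ?P = det ?P * det (diagonal_matrix f)"
      by (metis det_mul)
    then show ?thesis using inv dg by simp
  qed
  show "det S = (\<Prod>i\<in>UNIV. l i)"
    by (rule conj) (rule l)
  have "poly (charpoly S) x = poly (\<Prod>i\<in>UNIV. [:- l i, 1:]) x" for x
  proof -
    have "(mat x - S) *v b i = (x - l i) *\<^sub>R b i" for i
    proof -
      have "mat x = x *\<^sub>R (mat 1 :: real^'n^'n)"
        by (simp add: vec_eq_iff mat_def)
      then have "mat x *v b i = x *\<^sub>R b i"
        by (simp add: scaleR_matrix_vector_assoc[symmetric])
      then show ?thesis
        by (simp add: matrix_vector_mult_diff_rdistrib l scaleR_diff_left)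
    qed
    from conj[OF this] show ?thesis
      by (simp add: poly_charpoly poly_prod)
  qed
  then show "charpoly S = (\<Prod>i\<in>UNIV. [:- l i, 1:])"
    by (simp add: poly_eq_poly_eq_iff[symmetric] fun_eq_iff)
qed

text \<open>
The characteristic polynomial of the Gram matrix splits over the reals, hence the list of
singular values has full length, and its entries with number \<open>1\<close> and \<open>CARD('n)\<close> are its
maximum and minimum.
\<close>

lemma singular_values_from_eigenbasis:
  fixes M :: "real^'n^'n"
  assumes b: "orthogonal_matrix (columns_matrix b)"
    and l: "\<And>i. (transpose M ** M) *v b i = l i *\<^sub>R b i"
  shows "singular_value 1 M = Max (range (\<lambda>i. sqrt (l i)))"
    and "singular_value CARD('n) M = Min (range (\<lambda>i. sqrt (l i)))"
proof -
  let ?ms = "image_mset (\<lambda>i. sqrt (l i)) (mset_set (UNIV::'n set))"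
  have "proots (charpoly (transpose M ** M)) = (\<Sum>i\<in>UNIV. {#l i#})"
    unfolding charpoly_diagonalized(1)[OF b l] by (subst proots_prod) auto
  also have "\<dots> = image_mset l (mset_set UNIV)"
    by (simp add: sum_unfold_sum_mset)
  finally have sv: "singular_values M = rev (sorted_list_of_multiset ?ms)"
    by (simp add: singular_values_def multiset.map_comp o_def)
  let ?xs = "sorted_list_of_multiset ?ms"
  have len: "length ?xs = CARD('n)"
    by (metis mset_sorted_list_of_multiset size_image_mset size_mset size_mset_set)
  have st: "set ?xs = range (\<lambda>i. sqrt (l i))"
    by simp
  have srt: "sorted ?xs" by simp
  have d: "CARD('n) > 0" by simp
  have "?xs ! (CARD('n) - 1) \<in> set ?xs"
    using len d by (metis diff_less nth_mem zero_less_one)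
  moreover have "y \<le> ?xs ! (CARD('n) - 1)" if y: "y \<in> set ?xs" for y
  proof -
    obtain i where "i < length ?xs" "y = ?xs ! i"
      using y by (metis in_set_conv_nth)
    then show ?thesis
      using srt len by (metis One_nat_def Suc_pred d diff_less leD less_Suc_eq_le not_less_eq sorted_nth_mono zero_less_one)
  qed
  ultimately have mx: "Max (set ?xs) = ?xs ! (CARD('n) - 1)"
    by (intro Max_eqI) auto
  have mn: "Min (set ?xs) = ?xs ! 0"
  proof (intro Min_eqI)
    show "?xs ! 0 \<in> set ?xs" using len d by (metis nth_mem)
    fix y assume "y \<in> set ?xs"
    then obtain i where "i < length ?xs" "y = ?xs ! i"
      by (metis in_set_conv_nth)
    then show "?xs ! 0 \<le> y" using srt by (metis le0 sorted_nth_mono)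
  qed simp
  show "singular_value 1 M = Max (range (\<lambda>i. sqrt (l i)))"
    using mx len d unfolding st by (simp add: singular_value_def sv rev_nth)
  show "singular_value CARD('n) M = Min (range (\<lambda>i. sqrt (l i)))"
    using mn len d unfolding st by (simp add: singular_value_def sv rev_nth)
qed

lemma nonsingular_kernel:
  fixes M :: "real^'n^'n"
  assumes "det M \<noteq> 0" "M *v x = 0"
  shows "x = 0"
proof -
  obtain N where "N ** M = mat 1"
    using assms(1) by (metis invertible_det_nz invertible_def)
  then have "x = N *v (M *v x)" by (simp add: matrix_vector_mul_assoc)
  then show ?thesis using assms(2) by simp
qed

definition s_max :: "real^'n^'n \<Rightarrow> real" where "s_max M = singular_value 1 M"
definition s_min :: "real^'n^'n \<Rightarrow> real" where "s_min M = singular_value CARD('n) M"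

text \<open>
The vector \<open>y\<close> consists of the coordinates of \<open>x\<close> in the eigenbasis \<open>b\<close> of the Gram matrix.
\<close>

lemma singular_value_decomposition:
  fixes M :: "real^'n^'n"
  obtains b :: "'n \<Rightarrow> real^'n" and \<sigma> :: "'n \<Rightarrow> real"
  where "\<And>i. norm (b i) = 1" "\<And>i. norm (M *v b i) = \<sigma> i"
    "\<And>x. \<exists>y. norm y = norm x \<and> (norm (M *v x))\<^sup>2 = (\<Sum>i\<in>UNIV. (\<sigma> i)\<^sup>2 * (y $ i)\<^sup>2)"
    "s_max M = Max (range \<sigma>)" "s_min M = Min (range \<sigma>)"
    "\<bar>det M\<bar> = (\<Prod>i\<in>UNIV. \<sigma> i)"
proof -
  let ?S = "transpose M ** M"
  have quad: "x \<bullet> (?S *v x) = (norm (M *v x))\<^sup>2" for x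
    by (metis dot_lmul_matrix inner_commute matrix_vector_mul_assoc power2_norm_eq_inner transpose_matrix_vector
        transpose_transpose)
  have "transpose ?S = ?S"
    by (simp add: matrix_transpose_mul)
  from symmetric_spectral[OF this] obtain b l where b: "\<And>i. norm (b i) = 1"
    "orthogonal_matrix (columns_matrix b)" "\<And>i. ?S *v b i = l i *\<^sub>R b i" by blast
  have l: "l i = (norm (M *v b i))\<^sup>2" for i
    using quad[of "b i"] b(1)[of i] by (simp add: b(3) dot_square_norm)
  then have sq: "sqrt (l i) = norm (M *v b i)" for i
    by simp
  have ex: "\<exists>y. norm y = norm x \<and> (norm (M *v x))\<^sup>2 = (\<Sum>i\<in>UNIV. (norm (M *v b i))\<^sup>2 * (y $ i)\<^sup>2)" for x
  proof -
    let ?P = "columns_matrix b"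
    define y where "y = transpose ?P *v x"
    have x: "x = ?P *v y"
      using b(2) unfolding y_def orthogonal_matrix_def by (metis matrix_vector_mul_assoc matrix_vector_mul_lid)
    have n: "norm y = norm x"
      unfolding y_def
      by (rule orthogonal_transformation_norm, unfold orthogonal_transformation_matrix)
        (intro conjI matrix_vector_mul_linear, simp only: matrix_of_matrix_vector_mul orthogonal_matrix_transpose b(2))
    have x': "x = (\<Sum>i\<in>UNIV. y $ i *\<^sub>R b i)"
      by (subst x) (simp add: vec_eq_iff matrix_vector_mult_def columns_matrix_def mult.commute)
    have bx: "b i \<bullet> x = y $ i" for i
      by (simp add: y_def matrix_vector_mult_def transpose_def columns_matrix_def inner_vec_def)
    have "?S *v x = (\<Sum>i\<in>UNIV. (y $ i * l i) *\<^sub>R b i)"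
      by (subst x') (simp add: linear_sum[OF matrix_vector_mul_linear] matrix_vector_mult_scaleR b(3))
    then have "x \<bullet> (?S *v x) = (\<Sum>i\<in>UNIV. (norm (M *v b i))\<^sup>2 * (y $ i)\<^sup>2)"
      by (simp add: inner_sum_right inner_commute[of x] bx l power2_eq_square mult_ac)
    then show ?thesis
      using n quad by auto
  qed
  have "(det M)\<^sup>2 = (\<Prod>i\<in>UNIV. norm (M *v b i))\<^sup>2"
    using charpoly_diagonalized(2)[OF b(2,3)]
    by (simp add: det_mul power2_eq_square l flip: prod.distrib)
  then have "sqrt ((det M)\<^sup>2) = sqrt ((\<Prod>i\<in>UNIV. norm (M *v b i))\<^sup>2)"
    by (rule arg_cong)
  then have "\<bar>det M\<bar> = (\<Prod>i\<in>UNIV. norm (M *v b i))"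
    by (simp only: real_sqrt_abs abs_of_nonneg[OF prod_nonneg] norm_ge_zero)
  then show thesis
    by (intro that[of b "\<lambda>i. norm (M *v b i)"] b(1) ex refl
      singular_values_from_eigenbasis[OF b(2,3), unfolded sq, folded s_max_def s_min_def])
qed

text \<open>
From here on the extreme singular values are only used through this variational
description and through the two estimates that compare them with the determinant.
\<close>

lemma s_max_s_min_extremal:
  fixes M :: "real^'n^'n"
  shows s_max_upper: "norm (M *v x) \<le> s_max M * norm x"
    and s_min_lower: "s_min M * norm x \<le> norm (M *v x)"
    and s_max_attained: "\<exists>x. norm x = 1 \<and> norm (M *v x) = s_max M"
    and s_min_attained: "\<exists>x. norm x = 1 \<and> norm (M *v x) = s_min M"
    and s_max_s_min_det: "s_max M * s_min M ^ (CARD('n) - 1) \<le> \<bar>det M\<bar>"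
    and det_s_max_s_min: "\<bar>det M\<bar> \<le> s_max M ^ (CARD('n) - 1) * s_min M"
proof -
  obtain b :: "'n \<Rightarrow> real^'n" and \<sigma> :: "'n \<Rightarrow> real" where 1: "\<And>i. norm (b i) = 1" "\<And>i. norm (M *v b i) = \<sigma> i"
    and q: "\<And>x. \<exists>y. norm y = norm x \<and> (norm (M *v x))\<^sup>2 = (\<Sum>i\<in>UNIV. (\<sigma> i)\<^sup>2 * (y $ i)\<^sup>2)"
    and s: "s_max M = Max (range \<sigma>)" "s_min M = Min (range \<sigma>)"
    and d: "\<bar>det M\<bar> = (\<Prod>i\<in>UNIV. \<sigma> i)"
    by (rule singular_value_decomposition[of M]) (rule that; assumption)
  have nn: "\<sigma> i \<ge> 0" for i using 1(2)[of i] by (metis norm_ge_zero)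
  have le: "\<sigma> i \<le> s_max M" "s_min M \<le> \<sigma> i" for i
    by (auto simp: s)
  obtain im where im: "\<sigma> im = s_max M"
    using Max_in[of "range \<sigma>"] unfolding s by fastforce
  obtain jm where jm: "\<sigma> jm = s_min M"
    using Min_in[of "range \<sigma>"] unfolding s by fastforce
  have pos: "s_max M \<ge> 0" "s_min M \<ge> 0" using nn im jm by metis+
  obtain y where y: "norm y = norm x" "(norm (M *v x))\<^sup>2 = (\<Sum>i\<in>UNIV. (\<sigma> i)\<^sup>2 * (y $ i)\<^sup>2)"
    using q by blast
  have y2: "(norm x)\<^sup>2 = (\<Sum>i\<in>UNIV. (y $ i)\<^sup>2)"
    unfolding y(1)[symmetric] by (simp add: norm_vec_def L2_set_def sum_nonneg)
  have "(norm (M *v x))\<^sup>2 \<le> (s_max M * norm x)\<^sup>2"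
    unfolding y(2) power_mult_distrib y2 sum_distrib_left
    by (intro sum_mono mult_right_mono power_mono le nn) auto
  then show "norm (M *v x) \<le> s_max M * norm x"
    using pos by (auto intro: power2_le_imp_le)
  have "(s_min M * norm x)\<^sup>2 \<le> (norm (M *v x))\<^sup>2"
    unfolding y(2) power_mult_distrib y2 sum_distrib_left
    by (intro sum_mono mult_right_mono power_mono le pos) auto
  then show "s_min M * norm x \<le> norm (M *v x)"
    by (auto intro: power2_le_imp_le)
  show "\<exists>x. norm x = 1 \<and> norm (M *v x) = s_max M"
    using 1 im by metis
  show "\<exists>x. norm x = 1 \<and> norm (M *v x) = s_min M"
    using 1 jm by metis
  have "\<bar>det M\<bar> = \<sigma> im * (\<Prod>i\<in>UNIV - {im}. \<sigma> i)"
    unfolding d by (rule prod.remove) auto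
  moreover have "(\<Prod>i\<in>UNIV - {im}. \<sigma> i) \<ge> (\<Prod>i\<in>UNIV - {im}. s_min M)"
    by (rule prod_mono) (use le pos in auto)
  ultimately show "s_max M * s_min M ^ (CARD('n) - 1) \<le> \<bar>det M\<bar>"
    using pos by (simp add: im mult_left_mono)
  have "\<bar>det M\<bar> = \<sigma> jm * (\<Prod>i\<in>UNIV - {jm}. \<sigma> i)"
    unfolding d by (rule prod.remove) auto
  moreover have "(\<Prod>i\<in>UNIV - {jm}. \<sigma> i) \<le> (\<Prod>i\<in>UNIV - {jm}. s_max M)"
    by (rule prod_mono) (use le nn in auto)
  ultimately show "\<bar>det M\<bar> \<le> s_max M ^ (CARD('n) - 1) * s_min M"
    using pos by (simp add: jm mult_left_mono mult.commute)
qed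

lemma s_min_nonneg: "s_min M \<ge> 0"
  using s_min_attained[of M] norm_ge_zero by metis

lemma s_min_le_s_max: "s_min M \<le> s_max M"
  using s_min_attained[of M] s_max_upper[of M] by (metis mult.right_neutral)

lemma s_max_nonneg: "s_max M \<ge> 0"
  using s_min_nonneg s_min_le_s_max order_trans by blast

lemma s_min_pos: "det (M :: real^'n^'n) \<noteq> 0 \<Longrightarrow> s_min M > 0"
  using det_s_max_s_min[of M] s_min_nonneg[of M]
  by (metis abs_le_zero_iff less_eq_real_def mult_zero_right)

lemma norm_matrix_vector_le:
  fixes M :: "real^'n^'m"
  shows "norm (M *v x) \<le> norm M * norm x"
proof -
  have "(norm (M *v x))\<^sup>2 = (\<Sum>i\<in>UNIV. (M $ i \<bullet> x)\<^sup>2)"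
    by (simp add: norm_vec_def L2_set_def sum_nonneg matrix_vector_mul_component)
  also have "\<dots> \<le> (\<Sum>i\<in>UNIV. (norm (M $ i))\<^sup>2 * (norm x)\<^sup>2)"
    by (intro sum_mono) (metis Cauchy_Schwarz_ineq2 abs_ge_zero power2_abs power_mono power_mult_distrib)
  also have "\<dots> = (norm M * norm x)\<^sup>2"
    by (simp add: norm_vec_def[of M] L2_set_def sum_nonneg power_mult_distrib sum_distrib_right)
  finally show ?thesis
    by (auto intro: power2_le_imp_le)
qed

lemma norm_matrix_le_s_max: "norm M \<le> sqrt CARD('n) * s_max (M :: real^'n^'n)"
proof -
  have "(norm M)\<^sup>2 = (\<Sum>i\<in>UNIV. \<Sum>j\<in>UNIV. (M $ i $ j)\<^sup>2)"
    by (simp add: norm_vec_def L2_set_def sum_nonneg)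
  also have "\<dots> = (\<Sum>j\<in>UNIV. \<Sum>i\<in>UNIV. (M $ i $ j)\<^sup>2)"
    by (rule sum.swap)
  also have "\<dots> = (\<Sum>j\<in>UNIV. (norm (M *v axis j 1))\<^sup>2)"
    by (simp add: matrix_vector_mul_component inner_axis norm_vec_def L2_set_def sum_nonneg)
  also have "\<dots> \<le> (\<Sum>j\<in>(UNIV::'n set). (s_max M)\<^sup>2)"
  proof (intro sum_mono power_mono)
    show "norm (M *v axis j 1) \<le> s_max M" for j
      using s_max_upper[of M "axis j 1"] by simp
  qed auto
  also have "\<dots> = (sqrt CARD('n) * s_max M)\<^sup>2"
    by (simp add: power_mult_distrib)
  finally show ?thesis
    using s_max_nonneg[of M] by (auto intro: power2_le_imp_le)
qed

lemma s_max_diff: "s_max M \<le> s_max N + norm (M - N)"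
proof -
  obtain x where x: "norm x = 1" "norm (M *v x) = s_max M"
    using s_max_attained by blast
  have "M *v x = N *v x + (M - N) *v x"
    by (simp add: matrix_vector_mult_diff_rdistrib)
  then have "s_max M \<le> norm (N *v x) + norm ((M - N) *v x)"
    using x norm_triangle_ineq by metis
  also have "\<dots> \<le> s_max N + norm (M - N)"
    using s_max_upper[of N x] norm_matrix_vector_le[of "M - N" x] x by simp
  finally show ?thesis .
qed

lemma s_min_diff: "s_min M \<le> s_min N + norm (M - N)"
proof -
  obtain x where x: "norm x = 1" "norm (N *v x) = s_min N"
    using s_min_attained by blast
  have "M *v x = N *v x + (M - N) *v x"
    by (simp add: matrix_vector_mult_diff_rdistrib)
  then have "norm (M *v x) \<le> norm (N *v x) + norm ((M - N) *v x)"
    using norm_triangle_ineq by metis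
  also have "\<dots> \<le> s_min N + norm (M - N)"
    using norm_matrix_vector_le[of "M - N" x] x by simp
  finally show ?thesis
    using s_min_lower[of M x] x by simp
qed

text \<open>
The variational description makes the extreme singular values Lipschitz functions of the
matrix; this is how they become measurable, although they are defined through roots of
polynomials.
\<close>

lemma lipschitz_1_measurable:
  fixes f :: "'a::real_normed_vector \<Rightarrow> real"
  assumes "\<And>x y. f x \<le> f y + norm (x - y)"
  shows "f \<in> borel_measurable borel"
proof (rule borel_measurable_continuous_onI)
  have "dist (f x) (f y) \<le> 1 * dist x y" for x y
    using assms[of x y] assms[of y x] by (simp add: dist_norm norm_minus_commute abs_le_iff)
  then have "1-lipschitz_on UNIV f"
    by (intro lipschitz_onI) auto
  then show "continuous_on UNIV f"
    by (rule lipschitz_on_continuous_on)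
qed

lemma s_max_measurable [measurable]: "s_max \<in> borel_measurable borel"
  by (rule lipschitz_1_measurable) (rule s_max_diff)

lemma s_min_measurable [measurable]: "s_min \<in> borel_measurable borel"
  by (rule lipschitz_1_measurable) (rule s_min_diff)

definition condition_number :: "real^'n^'n \<Rightarrow> real" where
  "condition_number M = s_max M / s_min M"

lemma condition_number_ge_1: "det M \<noteq> 0 \<Longrightarrow> condition_number M \<ge> 1"
  unfolding condition_number_def using s_min_pos[of M] s_min_le_s_max[of M] by simp

text \<open>
The second inequality says that multiplication by a fixed nonsingular matrix cannot destroy
an already large condition number. It is what makes the growth rate insensitive to finitely
many factors.
\<close>

lemma condition_number_mult:
  fixes M N :: "real^'n^'n"
  assumes M: "det M \<noteq> 0" and N: "det N \<noteq> 0"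
  shows "condition_number (M ** N) \<le> condition_number M * condition_number N"
    and "condition_number M \<le> condition_number (M ** N) * condition_number N"
proof -
  have MN: "det (M ** N) \<noteq> 0" using M N by (simp add: det_mul)
  note pos = s_min_pos[OF M] s_min_pos[OF N] s_min_pos[OF MN]
  have mv: "(M ** N) *v x = M *v (N *v x)" for x by (simp add: matrix_vector_mul_assoc)
  obtain x where x: "norm x = 1" "norm ((M ** N) *v x) = s_max (M ** N)" using s_max_attained by blast
  have "s_max (M ** N) \<le> s_max M * norm (N *v x)"
    using x s_max_upper[of M "N *v x"] mv by metis
  also have "\<dots> \<le> s_max M * s_max N"
    using s_max_upper[of N x] x s_max_nonneg[of M] by (simp add: mult_left_mono)
  finally have 1: "s_max (M ** N) \<le> s_max M * s_max N" .
  obtain x where x: "norm x = 1" "norm ((M ** N) *v x) = s_min (M ** N)" using s_min_attained by blast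
  have "s_min M * s_min N \<le> s_min M * norm (N *v x)"
    using s_min_lower[of N x] x pos by (simp add: mult_left_mono)
  also have "\<dots> \<le> s_min (M ** N)"
    using x s_min_lower[of M "N *v x"] mv by metis
  finally have 2: "s_min M * s_min N \<le> s_min (M ** N)" .
  show "condition_number (M ** N) \<le> condition_number M * condition_number N"
    unfolding condition_number_def using 1 2 pos s_max_nonneg[of "M ** N"]
    by (simp add: frac_le)
  have surj: "\<exists>x. N *v x = y" for y
    using N by (metis invertible_det_nz invertible_def matrix_vector_mul_assoc matrix_vector_mul_lid)
  obtain y where y: "norm y = 1" "norm (M *v y) = s_max M" using s_max_attained by blast
  obtain x where x: "N *v x = y" using surj by blast
  have nx: "s_min N * norm x \<le> 1" using s_min_lower[of N x] x y by simp
  have "s_max M * s_min N \<le> s_max (M ** N) * (s_min N * norm x)"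
    using s_max_upper[of "M ** N" x] x y mv pos by (simp add: mult.commute mult.left_commute)
  also have "\<dots> \<le> s_max (M ** N)"
    using nx s_max_nonneg[of "M ** N"] by (simp add: mult_left_le)
  finally have 3: "s_max M * s_min N \<le> s_max (M ** N)" .
  obtain y where y: "norm y = 1" "norm (M *v y) = s_min M" using s_min_attained by blast
  obtain x where x: "N *v x = y" using surj by blast
  have nx: "1 \<le> s_max N * norm x" using s_max_upper[of N x] x y by simp
  have "s_min (M ** N) \<le> s_min (M ** N) * (s_max N * norm x)"
    using nx pos by simp
  also have "\<dots> \<le> s_min M * s_max N"
    using s_min_lower[of "M ** N" x] x y mv s_max_nonneg[of N]
    by (metis mult.commute mult.left_commute mult_left_mono)
  finally have 4: "s_min (M ** N) \<le> s_min M * s_max N" .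
  have "s_max M * (s_min (M ** N) * s_min N) = (s_max M * s_min N) * s_min (M ** N)" by simp
  also have "\<dots> \<le> s_max (M ** N) * (s_min M * s_max N)"
    using 3 4 pos s_max_nonneg[of "M ** N"] by (intro mult_mono) auto
  finally show "condition_number M \<le> condition_number (M ** N) * condition_number N"
    unfolding condition_number_def using pos by (simp add: field_simps)
qed

section \<open>Linear changes of variables for Lebesgue measure\<close>

lemma nn_integral_lborel_shift:
  fixes h :: "'a::euclidean_space \<Rightarrow> ennreal"
  assumes [measurable]: "h \<in> borel_measurable borel"
  shows "(\<integral>\<^sup>+x. h (a + x) \<partial>lborel) = (\<integral>\<^sup>+x. h x \<partial>lborel)"
  by (subst (2) lborel_distr_plus[symmetric, of a]) (simp add: nn_integral_distr)

lemma linear_measurable: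
  fixes f :: "'a::euclidean_space \<Rightarrow> 'b::real_normed_vector"
  shows "linear f \<Longrightarrow> f \<in> borel_measurable borel"
  by (intro borel_measurable_continuous_onI linear_continuous_on linear_conv_bounded_linear[THEN iffD1])

lemma unit_ball_finite_positive:
  obtains b :: real where "b > 0" "emeasure lborel (ball (0::'a::euclidean_space) 1) = ennreal b"
proof -
  let ?K = "emeasure lborel (ball (0::'a) 1)"
  have "?K > 0" "?K < \<infinity>"
    using emeasure_lborel_ball_finite by (simp_all add: emeasure_ball unit_ball_vol_pos)
  then show thesis
    using that by (metis ennreal_cases ennreal_less_zero_iff infinity_ennreal_def less_irrefl)
qed

lemma indicator_ball_measurable:
  "(indicator (ball 0 1) :: 'a::euclidean_space \<Rightarrow> ennreal) \<in> borel_measurable borel"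
  by (intro borel_measurable_indicator) auto

text \<open>
The image of Lebesgue measure under a linear bijection is translation invariant, so it is a
multiple of Lebesgue measure. With \<open>k\<close> the indicator of the unit ball, the double integral of
\<open>h (f x) * k (y - f x)\<close> is evaluated in both orders; comparing the results determines the
factor. The statement covers spaces of matrices, on which the linear map will be a
multiplication by a matrix.
\<close>

lemma linear_change_of_variables:
  fixes f :: "'a::euclidean_space \<Rightarrow> 'a"
  assumes f: "linear f" "inj f"
  obtains c :: real where "c > 0"
    "\<And>h. h \<in> borel_measurable borel \<Longrightarrow> (\<integral>\<^sup>+x. h x \<partial>lborel) = ennreal c * (\<integral>\<^sup>+x. h (f x) \<partial>lborel)"
proof -
  have [measurable]: "f \<in> borel_measurable borel"
    using f(1) by (rule linear_measurable)
  obtain g where g: "linear g" "\<And>x. f (g x) = x"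
    using linear_injective_isomorphism[OF f] by blast
  define k :: "'a \<Rightarrow> ennreal" where "k = indicator (ball 0 1)"
  have [measurable]: "k \<in> borel_measurable borel"
    unfolding k_def by (rule indicator_ball_measurable)
  have k_neg: "k (- x) = k x" for x by (simp add: k_def indicator_def)
  define K where "K = (\<integral>\<^sup>+x. k x \<partial>lborel)"
  define I where "I = (\<integral>\<^sup>+x. k (f x) \<partial>lborel)"
  have main: "(\<integral>\<^sup>+x. h x \<partial>lborel) * I = (\<integral>\<^sup>+x. h (f x) \<partial>lborel) * K"
    if [measurable]: "h \<in> borel_measurable borel" for h :: "'a \<Rightarrow> ennreal"
  proof -
    have "(\<integral>\<^sup>+x. h (f x) \<partial>lborel) * K = (\<integral>\<^sup>+x. h (f x) * K \<partial>lborel)"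
      by (simp add: nn_integral_multc)
    also have "\<dots> = (\<integral>\<^sup>+x. \<integral>\<^sup>+y. h (f x) * k (- f x + y) \<partial>lborel \<partial>lborel)"
    proof (rule nn_integral_cong)
      fix x
      have "(\<integral>\<^sup>+y. k (- f x + y) \<partial>lborel) = K"
        unfolding K_def by (rule nn_integral_lborel_shift) measurable
      moreover have "(\<integral>\<^sup>+y. h (f x) * k (- f x + y) \<partial>lborel) = h (f x) * (\<integral>\<^sup>+y. k (- f x + y) \<partial>lborel)"
        by (rule nn_integral_cmult) measurable
      ultimately show "h (f x) * K = (\<integral>\<^sup>+y. h (f x) * k (- f x + y) \<partial>lborel)" by simp
    qed
    also have "\<dots> = (\<integral>\<^sup>+y. \<integral>\<^sup>+x. h (f x) * k (- f x + y) \<partial>lborel \<partial>lborel)"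
      by (rule lborel_pair.Fubini') measurable
    also have "\<dots> = (\<integral>\<^sup>+y. \<integral>\<^sup>+x. h (f x + y) * k (f x) \<partial>lborel \<partial>lborel)"
    proof (rule nn_integral_cong)
      fix y
      have "(\<integral>\<^sup>+x. h (f x) * k (- f x + y) \<partial>lborel)
          = (\<integral>\<^sup>+x. h (f (g y + x)) * k (- f (g y + x) + y) \<partial>lborel)"
        by (rule nn_integral_lborel_shift[symmetric]) measurable
      then show "(\<integral>\<^sup>+x. h (f x) * k (- f x + y) \<partial>lborel) = (\<integral>\<^sup>+x. h (f x + y) * k (f x) \<partial>lborel)"
        using k_neg by (simp add: linear_add[OF f(1)] g(2) add.commute)
    qed
    also have "\<dots> = (\<integral>\<^sup>+x. \<integral>\<^sup>+y. h (f x + y) * k (f x) \<partial>lborel \<partial>lborel)"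
      by (rule lborel_pair.Fubini'[symmetric]) measurable
    also have "\<dots> = (\<integral>\<^sup>+x. h x \<partial>lborel) * I"
      by (simp add: nn_integral_multc nn_integral_cmult nn_integral_lborel_shift I_def)
    finally show ?thesis by simp
  qed
  have K: "K = emeasure lborel (ball (0::'a) 1)" by (simp add: K_def k_def)
  have op: "open (f -` ball 0 1)"
    using f(1) by (intro open_vimage) (auto intro: linear_continuous_on simp: linear_conv_bounded_linear)
  have "k (f x) = indicator (f -` ball 0 1) x" for x
    by (simp add: k_def indicator_def)
  then have I: "I = emeasure lborel (f -` ball 0 1)"
    unfolding I_def using borel_open[OF op] by simp
  have bnd: "bounded (f -` ball 0 1)"
  proof -
    have "f -` ball 0 1 \<subseteq> g ` ball 0 1"
      using g(2) f(2) by (auto simp: image_iff inj_def) (metis dist_0_norm g(2) mem_ball_0)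
    then show ?thesis
      using g(1) bounded_linear_image[OF bounded_ball] bounded_subset linear_conv_bounded_linear by metis
  qed
  have "I > 0" "I < \<infinity>"
  proof -
    have "0 \<in> f -` ball 0 1" by (simp add: linear_0[OF f(1)])
    then have "f -` ball 0 1 \<noteq> {}" by blast
    then have "\<not> negligible (f -` ball 0 1)"
      using open_not_negligible[OF op] by blast
    then have "f -` ball 0 1 \<notin> null_sets lborel"
      using null_sets_completion_iff[of "f -` ball 0 1" lborel] borel_open[OF op]
      by (simp add: negligible_iff_null_sets)
    then show "I > 0"
      unfolding I using borel_open[OF op] by (auto simp: null_sets_def zero_less_iff_neq_zero)
    show "I < \<infinity>"
      unfolding I using bnd by (rule emeasure_bounded_finite)
  qed
  then obtain a where a: "I = ennreal a" "a > 0"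
    by (metis ennreal_cases ennreal_less_zero_iff infinity_ennreal_def less_irrefl)
  moreover obtain b where "K = ennreal b" "b > 0"
    unfolding K by (rule unit_ball_finite_positive)
  ultimately have ab: "I = ennreal a" "K = ennreal b" "a > 0" "b > 0" by auto
  show thesis
  proof (rule that[of "b / a"])
    show "b / a > 0" using ab by simp
    fix h :: "'a \<Rightarrow> ennreal" assume "h \<in> borel_measurable borel"
    from main[OF this] have eq: "(\<integral>\<^sup>+x. h x \<partial>lborel) * ennreal a = (\<integral>\<^sup>+x. h (f x) \<partial>lborel) * ennreal b"
      by (simp add: ab)
    have "(\<integral>\<^sup>+x. h x \<partial>lborel) = (\<integral>\<^sup>+x. h x \<partial>lborel) * ennreal a * ennreal (1 / a)"
      using ab by (simp add: mult.assoc ennreal_mult[symmetric])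
    also have "\<dots> = (\<integral>\<^sup>+x. h (f x) \<partial>lborel) * (ennreal b * ennreal (1 / a))"
      unfolding eq by (simp add: mult.assoc)
    also have "ennreal b * ennreal (1 / a) = ennreal (b / a)"
      using ab by (simp add: ennreal_mult[symmetric])
    finally show "(\<integral>\<^sup>+x. h x \<partial>lborel) = ennreal (b / a) * (\<integral>\<^sup>+x. h (f x) \<partial>lborel)"
      by (simp add: mult.commute)
  qed
qed

text \<open>
The preimage of the unit ball under an expanding map lies in the unit ball, so the Jacobian
is at least one.
\<close>

lemma expanding_change_of_variables:
  fixes f :: "'a::euclidean_space \<Rightarrow> 'a"
  assumes f: "linear f" and ge: "\<And>x. norm x \<le> norm (f x)"
  obtains c :: real where "c \<ge> 1"
    "\<And>h. h \<in> borel_measurable borel \<Longrightarrow> (\<integral>\<^sup>+x. h x \<partial>lborel) = ennreal c * (\<integral>\<^sup>+x. h (f x) \<partial>lborel)"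
proof -
  have "inj f"
    unfolding linear_injective_0[OF f] using ge by (metis norm_le_zero_iff norm_zero)
  from linear_change_of_variables[OF f this] obtain c where c: "c > 0"
    "\<And>h. h \<in> borel_measurable borel \<Longrightarrow> (\<integral>\<^sup>+x. h x \<partial>lborel) = ennreal c * (\<integral>\<^sup>+x. h (f x) \<partial>lborel)"
    by blast
  obtain b where b: "b > 0" "emeasure lborel (ball (0::'a) 1) = ennreal b"
    by (rule unit_ball_finite_positive)
  have [measurable]: "f \<in> borel_measurable borel" using f by (rule linear_measurable)
  have "ennreal b = ennreal c * (\<integral>\<^sup>+x. indicator (ball 0 1) (f x) \<partial>lborel)"
    using c(2)[OF indicator_ball_measurable] b by simp
  also have "\<dots> \<le> ennreal c * (\<integral>\<^sup>+x. indicator (ball 0 1) (x::'a) \<partial>lborel)"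
  proof (intro mult_left_mono nn_integral_mono)
    show "indicator (ball 0 1) (f x) \<le> (indicator (ball 0 1) x :: ennreal)" for x
      using ge[of x] by (auto simp: indicator_def)
  qed auto
  also have "\<dots> = ennreal (c * b)"
    using b c by (simp add: ennreal_mult)
  finally have "c \<ge> 1" using b c by simp
  then show thesis using that c by blast
qed

lemma isometric_change_of_variables:
  fixes f :: "'a::euclidean_space \<Rightarrow> 'a"
  assumes f: "orthogonal_transformation f" and h: "h \<in> borel_measurable borel"
  shows "(\<integral>\<^sup>+x. h x \<partial>lborel) = (\<integral>\<^sup>+x. h (f x) \<partial>lborel)"
proof -
  have l: "linear f" and n: "\<And>x. norm (f x) = norm x"
    using f by (auto simp: orthogonal_transformation)
  obtain c where c: "c \<ge> 1"
    "\<And>h. h \<in> borel_measurable borel \<Longrightarrow> (\<integral>\<^sup>+x. h x \<partial>lborel) = ennreal c * (\<integral>\<^sup>+x. h (f x) \<partial>lborel)"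
    using expanding_change_of_variables[OF l] n by (metis order_refl)
  obtain b where b: "b > 0" "emeasure lborel (ball (0::'a) 1) = ennreal b"
    by (rule unit_ball_finite_positive)
  have "indicator (ball 0 1) (f x) = (indicator (ball 0 1) x :: ennreal)" for x
    using n by (simp add: indicator_def)
  then have "ennreal b = ennreal (c * b)"
    using c(2)[OF indicator_ball_measurable] b c(1) by (simp add: ennreal_mult)
  then have "c = 1" using b c by (simp add: ennreal_inj)
  then show ?thesis using c(2)[OF h] by simp
qed

lemma Basis_vec_image: "(Basis :: (real^'n) set) = range (\<lambda>i. axis i 1)"
  by (auto simp: Basis_vec_def)

lemma diagonal_change_of_variables:
  fixes \<sigma> :: "'n::finite \<Rightarrow> real"
  assumes \<sigma>: "\<And>i. \<sigma> i > 0" and [measurable]: "h \<in> borel_measurable borel"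
  shows "(\<integral>\<^sup>+x. h x \<partial>lborel) = ennreal (\<Prod>i\<in>UNIV. \<sigma> i) * (\<integral>\<^sup>+x. h (diagonal_matrix \<sigma> *v x) \<partial>lborel)"
proof -
  define c where "c j = (\<chi> i. \<sigma> i) \<bullet> j" for j :: "real^'n"
  have c: "c (axis i 1) = \<sigma> i" for i by (simp add: c_def inner_axis)
  have T: "0 + (\<Sum>j\<in>Basis. (c j * (x \<bullet> j)) *\<^sub>R j) = diagonal_matrix \<sigma> *v x" for x :: "real^'n"
  proof -
    have "(\<Sum>j\<in>Basis. (c j * (x \<bullet> j)) *\<^sub>R j) = (\<Sum>i\<in>UNIV. (\<sigma> i * x $ i) *\<^sub>R axis i 1)"
      unfolding Basis_vec_image by (subst sum.reindex) (auto simp: inj_on_def axis_eq_axis c inner_axis)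
    then show ?thesis
      by (simp add: vec_eq_iff diagonal_matrix_def matrix_vector_mult_def axis_def if_distrib if_distribR cong: if_cong)
  qed
  have "(\<Prod>j\<in>Basis. \<bar>c j\<bar>) = (\<Prod>i\<in>UNIV. \<bar>\<sigma> i\<bar>)"
    unfolding Basis_vec_image by (subst prod.reindex) (auto simp: inj_on_def axis_eq_axis c)
  also have "\<dots> = (\<Prod>i\<in>UNIV. \<sigma> i)"
    using \<sigma> by (intro prod.cong) (auto simp: less_imp_le)
  finally have pr: "(\<Prod>j\<in>Basis. \<bar>c j\<bar>) = (\<Prod>i\<in>UNIV. \<sigma> i)" .
  have "c j \<noteq> 0" if "j \<in> Basis" for j
    using that \<sigma> c unfolding Basis_vec_image by (auto simp: less_le)
  from lborel_affine_euclidean[of c 0, OF this, unfolded T pr]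
  have eq: "(lborel :: (real^'n) measure)
    = density (distr lborel borel ((*v) (diagonal_matrix \<sigma>))) (\<lambda>_. ennreal (\<Prod>i\<in>UNIV. \<sigma> i))" by simp
  have [measurable]: "(*v) (diagonal_matrix \<sigma>) \<in> borel_measurable borel"
    by (rule linear_measurable) (rule matrix_vector_mul_linear)
  show ?thesis
    by (subst eq) (simp add: nn_integral_density nn_integral_distr nn_integral_cmult)
qed

text \<open>
By the singular value decomposition \<open>M\<close> is a product of two isometries and a diagonal
matrix, for which the Jacobians are known.
\<close>

theorem matrix_change_of_variables:
  fixes M :: "real^'n^'n"
  assumes M: "det M \<noteq> 0" and h [measurable]: "h \<in> borel_measurable borel"
  shows "(\<integral>\<^sup>+x. h x \<partial>lborel) = ennreal \<bar>det M\<bar> * (\<integral>\<^sup>+x. h (M *v x) \<partial>lborel)"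
proof -
  let ?S = "transpose M ** M"
  have quad: "x \<bullet> (?S *v y) = (M *v x) \<bullet> (M *v y)" for x y
    by (metis dot_lmul_matrix inner_commute matrix_vector_mul_assoc transpose_matrix_vector
        transpose_transpose)
  have "transpose ?S = ?S"
    by (simp add: matrix_transpose_mul)
  from symmetric_spectral[OF this] obtain b :: "'n \<Rightarrow> real^'n" and l where b: "\<And>i. norm (b i) = 1"
    "orthogonal_matrix (columns_matrix b)" "\<And>i. ?S *v b i = l i *\<^sub>R b i" by blast
  let ?P = "columns_matrix b"
  define \<sigma> where "\<sigma> i = norm (M *v b i)" for i
  have col: "column i (columns_matrix v) = v i" for i and v :: "'n \<Rightarrow> real^'n"
    by (simp add: column_def columns_matrix_def vec_eq_iff)
  have bo: "b i \<bullet> b j = 0" if "i \<noteq> j" for i j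
    using b(2) that unfolding orthogonal_matrix_orthonormal_columns col orthogonal_def by blast
  have \<sigma>: "\<sigma> i > 0" for i
  proof -
    have "M *v b i \<noteq> 0"
      using nonsingular_kernel[OF M, of "b i"] b(1)[of i] by auto
    then show ?thesis by (simp add: \<sigma>_def)
  qed
  \<comment> \<open>The images of the eigenbasis are orthogonal; normalised, they are the columns of the second isometry.\<close>
  define u where "u i = (1 / \<sigma> i) *\<^sub>R (M *v b i)" for i
  let ?Q = "columns_matrix u"
  have Q: "orthogonal_matrix ?Q"
    unfolding orthogonal_matrix_orthonormal_columns col
  proof safe
    show "norm (u i) = 1" for i using \<sigma>[of i] by (simp add: u_def \<sigma>_def)
    show "orthogonal (u i) (u j)" if "i \<noteq> j" for i j
      using bo[OF that] by (simp add: orthogonal_def u_def quad[symmetric] b(3))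
  qed
  have MP: "M ** ?P = ?Q ** diagonal_matrix \<sigma>"
  proof -
    have "(M ** ?P) $ i $ j = (?Q ** diagonal_matrix \<sigma>) $ i $ j" for i j
    proof -
      have "(M ** ?P) $ i $ j = (M *v b j) $ i"
        by (simp add: matrix_matrix_mult_def matrix_vector_mult_def columns_matrix_def)
      also have "\<dots> = u j $ i * \<sigma> j"
        using \<sigma>[of j] by (simp add: u_def)
      also have "\<dots> = (?Q ** diagonal_matrix \<sigma>) $ i $ j"
        by (simp add: matrix_matrix_mult_def columns_matrix_def diagonal_matrix_def if_distrib cong: if_cong)
      finally show ?thesis .
    qed
    then show ?thesis by (simp add: vec_eq_iff)
  qed
  have "det (diagonal_matrix \<sigma>) = (\<Prod>i\<in>UNIV. \<sigma> i)"
    by (subst det_diagonal) (auto simp: diagonal_matrix_def)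
  then have dM: "\<bar>det M\<bar> = (\<Prod>i\<in>UNIV. \<sigma> i)"
    using arg_cong[OF MP, of "\<lambda>N. \<bar>det N\<bar>"] det_orthogonal_matrix[OF Q] det_orthogonal_matrix[OF b(2)] \<sigma>
    by (auto simp: det_mul abs_mult prod_nonneg less_imp_le)
  have M_eq: "M *v x = ?Q *v (diagonal_matrix \<sigma> *v (transpose ?P *v x))" for x
  proof -
    have "?P ** transpose ?P = mat 1" using b(2) by (simp add: orthogonal_matrix_def)
    then have "M = (M ** ?P) ** transpose ?P"
      by (metis matrix_mul_assoc matrix_mul_rid)
    then show ?thesis unfolding MP by (metis matrix_vector_mul_assoc)
  qed
  have ot: "orthogonal_transformation ((*v) N)" if "orthogonal_matrix N" for N :: "real^'n^'n"
    unfolding orthogonal_transformation_matrix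
    by (intro conjI matrix_vector_mul_linear, simp only: matrix_of_matrix_vector_mul that)
  have [measurable]: "(*v) N \<in> borel_measurable borel" for N :: "real^'n^'n"
    by (rule linear_measurable) (rule matrix_vector_mul_linear)
  have "(\<integral>\<^sup>+x. h x \<partial>lborel) = (\<integral>\<^sup>+x. h (?Q *v x) \<partial>lborel)"
    by (rule isometric_change_of_variables[OF ot[OF Q] h])
  also have "\<dots> = ennreal (\<Prod>i\<in>UNIV. \<sigma> i) * (\<integral>\<^sup>+x. h (?Q *v (diagonal_matrix \<sigma> *v x)) \<partial>lborel)"
    by (rule diagonal_change_of_variables[OF \<sigma>]) measurable
  also have "(\<integral>\<^sup>+x. h (?Q *v (diagonal_matrix \<sigma> *v x)) \<partial>lborel)
    = (\<integral>\<^sup>+x. h (?Q *v (diagonal_matrix \<sigma> *v (transpose ?P *v x))) \<partial>lborel)"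
    by (rule isometric_change_of_variables[OF ot]) (use b(2) in \<open>simp only: orthogonal_matrix_transpose\<close>, measurable)
  finally show ?thesis
    by (simp only: M_eq dM)
qed

section \<open>Norms of functions on the space of directions\<close>

text \<open>
The shell is a fundamental domain for the dilation by \<open>2\<close>. Functions of degree \<open>- d / 2\<close> on
\<open>d\<close>-space stand for functions on the space of directions, and the integral of the square over
the shell, a constant multiple of the integral over the sphere, is the square of their norm.
\<close>

definition dyadic_shell :: "'a::real_normed_vector set" where
  "dyadic_shell = {x. 1 \<le> norm x \<and> norm x < 2}"

lemma dyadic_shell_measurable [measurable]: "dyadic_shell \<in> sets (borel :: 'a::euclidean_space measure)"
  unfolding dyadic_shell_def by measurable

text \<open>
The dilates of the shell by the integer powers of \<open>2\<close> tile the space without the origin;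
the integers are enumerated by \<open>int_decode\<close> so that sums over them become series.
\<close>

lemma dyadic_shell_tiling:
  fixes x :: "'a::real_normed_vector"
  assumes "x \<noteq> 0"
  shows "(\<Sum>n. indicator dyadic_shell ((2 powr of_int (int_decode n)) *\<^sub>R x)) = (1::ennreal)"
    and "(\<Sum>n. indicator dyadic_shell ((2 powr - of_int (int_decode n)) *\<^sub>R x)) = (1::ennreal)"
proof -
  \<comment> \<open>The only exponent that brings \<open>x\<close> into the shell.\<close>
  define k where "k = - \<lfloor>log 2 (norm x)\<rfloor>"
  have x: "norm x > 0" using assms by simp
  have iff: "(2 powr of_int j) *\<^sub>R x \<in> dyadic_shell \<longleftrightarrow> j = k" for j
  proof -
    have "(2 powr of_int j) *\<^sub>R x \<in> dyadic_shell \<longleftrightarrow>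
      2 powr 0 \<le> 2 powr (of_int j + log 2 (norm x)) \<and> 2 powr (of_int j + log 2 (norm x)) < 2 powr 1"
      using x by (simp add: dyadic_shell_def powr_add)
    also have "\<dots> \<longleftrightarrow> 0 \<le> of_int j + log 2 (norm x) \<and> of_int j + log 2 (norm x) < 1"
      by (subst powr_le_cancel_iff, simp, subst powr_less_cancel_iff) simp_all
    also have "\<dots> \<longleftrightarrow> j = k"
      unfolding k_def by linarith
    finally show ?thesis .
  qed
  have 1: "(\<lambda>n. indicator dyadic_shell ((2 powr of_int (int_decode n)) *\<^sub>R x)) = (\<lambda>n. if n = int_encode k then 1 else (0::ennreal))"
    using iff by (auto simp: fun_eq_iff indicator_def)
  show "(\<Sum>n. indicator dyadic_shell ((2 powr of_int (int_decode n)) *\<^sub>R x)) = (1::ennreal)"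
    unfolding 1 using sums_single[of "int_encode k" "\<lambda>_. 1::ennreal"] by (simp add: sums_iff)
  have "indicator dyadic_shell ((2 powr - of_int (int_decode n)) *\<^sub>R x) = (if n = int_encode (- k) then 1 else (0::ennreal))" for n
    using iff[of "- int_decode n"] by (auto simp: indicator_def)
  then have 2: "(\<lambda>n. indicator dyadic_shell ((2 powr - of_int (int_decode n)) *\<^sub>R x)) = (\<lambda>n. if n = int_encode (- k) then 1 else (0::ennreal))"
    by blast
  show "(\<Sum>n. indicator dyadic_shell ((2 powr - of_int (int_decode n)) *\<^sub>R x)) = (1::ennreal)"
    unfolding 2 using sums_single[of "int_encode (-k)" "\<lambda>_. 1::ennreal"] by (simp add: sums_iff)
qed

definition homogeneous_of_degree :: "real \<Rightarrow> ('a::real_vector \<Rightarrow> ennreal) \<Rightarrow> bool" where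
  "homogeneous_of_degree r F \<longleftrightarrow> (\<forall>s>0. \<forall>x. F (s *\<^sub>R x) = ennreal (s powr r) * F x)"

lemma nn_integral_lborel_scale:
  fixes h :: "'a::euclidean_space \<Rightarrow> ennreal"
  assumes [measurable]: "h \<in> borel_measurable borel" and s: "s > 0"
  shows "(\<integral>\<^sup>+x. h x \<partial>lborel) = ennreal (s ^ DIM('a)) * (\<integral>\<^sup>+x. h (s *\<^sub>R x) \<partial>lborel)"
  using s by (subst lborel_affine[of s 0])
    (simp_all add: nn_integral_density nn_integral_distr nn_integral_cmult)

text \<open>
The measure with density \<open>G\<close> is invariant under dilations, so it gives the same mass to any
two fundamental domains of the dilation by \<open>2\<close>, here the shell and its preimage under \<open>M\<close>:
both are cut into the pieces that a power of \<open>2\<close> carries from one into the other. For singular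
\<open>M\<close> the left-hand side vanishes, which is why the statement is an inequality.
\<close>

theorem shell_integral_invariant:
  fixes G :: "real^'n \<Rightarrow> ennreal" and M :: "real^'n^'n"
  assumes [measurable]: "G \<in> borel_measurable borel"
    and hom: "homogeneous_of_degree (- real CARD('n)) G"
  shows "(\<integral>\<^sup>+x\<in>dyadic_shell. ennreal \<bar>det M\<bar> * G (M *v x) \<partial>lborel) \<le> (\<integral>\<^sup>+x\<in>dyadic_shell. G x \<partial>lborel)"
proof (cases "det M = 0")
  case False
  define S :: "(real^'n) set" where "S = dyadic_shell"
  define I :: "real^'n \<Rightarrow> ennreal" where "I = indicator S"
  have [measurable]: "I \<in> borel_measurable borel"
    unfolding I_def S_def by measurable
  have [measurable]: "(*v) M \<in> borel_measurable borel"
    by (rule linear_measurable) (rule matrix_vector_mul_linear)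
  have M0: "M *v x \<noteq> 0" if "x \<noteq> 0" for x
    using nonsingular_kernel[OF False] that by blast
  let ?p = "\<lambda>n. 2 powr of_int (int_decode n) :: real"
  let ?q = "\<lambda>n. 2 powr - of_int (int_decode n) :: real"
  have AE0: "AE x in lborel. (x::real^'n) \<noteq> 0"
    by (rule AE_lborel_singleton)
  have "(\<integral>\<^sup>+x. G (M *v x) * I x \<partial>lborel) = (\<integral>\<^sup>+x. (\<Sum>n. G (M *v x) * I x * I (?p n *\<^sub>R (M *v x))) \<partial>lborel)"
    using AE0 by (intro nn_integral_cong_AE, eventually_elim)
      (simp add: I_def S_def dyadic_shell_tiling(1)[OF M0])
  also have "\<dots> = (\<Sum>n. \<integral>\<^sup>+x. G (M *v x) * I x * I (?p n *\<^sub>R (M *v x)) \<partial>lborel)"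
    by (rule nn_integral_suminf) measurable
  also have "\<dots> = (\<Sum>n. \<integral>\<^sup>+x. G (M *v x) * I (M *v x) * I (?q n *\<^sub>R x) \<partial>lborel)"
  proof (rule suminf_cong)
    fix n
    have q: "?q n > 0" "?p n * ?q n = 1" by (auto simp: powr_add[symmetric])
    have qd: "ennreal (?q n ^ CARD('n)) * ennreal (?q n powr - real CARD('n)) = 1"
      using q(1) by (simp add: ennreal_mult[symmetric] powr_realpow[symmetric] powr_add[symmetric] del: powr_powr)
    have "(\<integral>\<^sup>+x. G (M *v x) * I x * I (?p n *\<^sub>R (M *v x)) \<partial>lborel)
      = ennreal (?q n ^ CARD('n)) * (\<integral>\<^sup>+x. G (M *v (?q n *\<^sub>R x)) * I (?q n *\<^sub>R x) * I (?p n *\<^sub>R (M *v (?q n *\<^sub>R x))) \<partial>lborel)"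
      by (subst nn_integral_lborel_scale[OF _ q(1)]) simp_all
    also have "\<dots> = ennreal (?q n ^ CARD('n)) * (\<integral>\<^sup>+x. ennreal (?q n powr - real CARD('n)) * (G (M *v x) * I (M *v x) * I (?q n *\<^sub>R x)) \<partial>lborel)"
      using q hom by (simp add: matrix_vector_mult_scaleR homogeneous_of_degree_def mult_ac)
    also have "\<dots> = (ennreal (?q n ^ CARD('n)) * ennreal (?q n powr - real CARD('n))) * (\<integral>\<^sup>+x. G (M *v x) * I (M *v x) * I (?q n *\<^sub>R x) \<partial>lborel)"
      by (subst nn_integral_cmult) (simp_all add: mult.assoc)
    finally show "(\<integral>\<^sup>+x. G (M *v x) * I x * I (?p n *\<^sub>R (M *v x)) \<partial>lborel) = (\<integral>\<^sup>+x. G (M *v x) * I (M *v x) * I (?q n *\<^sub>R x) \<partial>lborel)"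
      unfolding qd by simp
  qed
  also have "\<dots> = (\<integral>\<^sup>+x. (\<Sum>n. G (M *v x) * I (M *v x) * I (?q n *\<^sub>R x)) \<partial>lborel)"
    by (rule nn_integral_suminf[symmetric]) measurable
  also have "\<dots> = (\<integral>\<^sup>+x. G (M *v x) * I (M *v x) \<partial>lborel)"
    using AE0 by (intro nn_integral_cong_AE, eventually_elim)
      (simp add: I_def S_def dyadic_shell_tiling(2))
  finally have eq: "(\<integral>\<^sup>+x. G (M *v x) * I x \<partial>lborel) = (\<integral>\<^sup>+x. G (M *v x) * I (M *v x) \<partial>lborel)" .
  have "(\<integral>\<^sup>+x. ennreal \<bar>det M\<bar> * G (M *v x) * I x \<partial>lborel) = ennreal \<bar>det M\<bar> * (\<integral>\<^sup>+x. G (M *v x) * I x \<partial>lborel)"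
    by (subst nn_integral_cmult[symmetric]) (simp_all add: mult.assoc)
  also have "\<dots> = (\<integral>\<^sup>+x. G x * I x \<partial>lborel)"
    unfolding eq by (rule matrix_change_of_variables[OF False, symmetric]) measurable
  finally show ?thesis by (simp add: I_def S_def)
qed simp

text \<open>
The hypothesis on the integrals says that \<open>h\<close> is orthogonal to
\<open>\<psi> = \<kappa> 1\<^sub>U - 1\<^sub>V\<close>, whereas the constant \<open>1\<close> is not. Replacing \<open>1\<close> by a shorter
vector \<open>1 - t \<psi>\<close> improves the Cauchy-Schwarz inequality for \<open>h * 1\<close>. The sets may overlap,
because the cross term in the norm of \<open>\<psi>\<close> has the favourable sign.
\<close>

lemma orthogonality_defect:
  fixes h :: "'a \<Rightarrow> ennreal"
  assumes "prob_space M" and h [measurable]: "h \<in> borel_measurable M"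
    and U [measurable]: "U \<in> sets M" and V [measurable]: "V \<in> sets M"
    and muV: "measure M V = \<mu> * measure M U" and mu: "\<mu> > 0" and kappa: "\<kappa> > \<mu>"
    and int: "(\<integral>\<^sup>+x\<in>V. h x \<partial>M) = ennreal \<kappa> * (\<integral>\<^sup>+x\<in>U. h x \<partial>M)"
  shows "(\<integral>\<^sup>+x. h x \<partial>M)\<^sup>2 \<le> ennreal (1 - measure M U * (\<kappa> - \<mu>)\<^sup>2 / (\<kappa>\<^sup>2 + \<mu>)) * (\<integral>\<^sup>+x. (h x)\<^sup>2 \<partial>M)"
proof -
  interpret prob_space M by fact
  \<comment> \<open>For disjoint \<open>U\<close> and \<open>V\<close> this choice makes \<open>1 - t \<psi>\<close> as short as possible.\<close>
  define t where "t = (\<kappa> - \<mu>) / (\<kappa>\<^sup>2 + \<mu>)"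
  define c where "c = 1 - measure M U * (\<kappa> - \<mu>)\<^sup>2 / (\<kappa>\<^sup>2 + \<mu>)"
  have kp: "\<kappa> > 0" using mu kappa by simp
  have den: "\<kappa>\<^sup>2 + \<mu> > 0" using mu kp by (simp add: add_pos_pos)
  have t0: "t > 0" using kappa den by (simp add: t_def)
  have tk: "t * \<kappa> \<le> 1"
    using den mu kp by (simp add: t_def field_simps power2_eq_square)
  have "(\<kappa> - \<mu>)\<^sup>2 \<le> \<kappa>\<^sup>2"
    using mu kappa by (intro power_mono) auto
  then have "(\<kappa> - \<mu>)\<^sup>2 < \<kappa>\<^sup>2 + \<mu>" using mu by simp
  then have "(\<kappa> - \<mu>)\<^sup>2 / (\<kappa>\<^sup>2 + \<mu>) < 1" using den by simp
  moreover have "measure M U * ((\<kappa> - \<mu>)\<^sup>2 / (\<kappa>\<^sup>2 + \<mu>)) \<le> 1 * ((\<kappa> - \<mu>)\<^sup>2 / (\<kappa>\<^sup>2 + \<mu>))"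
    using den by (intro mult_right_mono) auto
  ultimately have c0: "c > 0" by (simp add: c_def)
  show ?thesis
  proof (cases "(\<integral>\<^sup>+x. (h x)\<^sup>2 \<partial>M) = \<infinity>")
    case True
    then show ?thesis using c0 by (simp add: c_def[symmetric] ennreal_mult_top)
  next
    case False
    have "(\<integral>\<^sup>+x. h x * 1 \<partial>M)\<^sup>2 \<le> (\<integral>\<^sup>+x. (h x)\<^sup>2 \<partial>M) * (\<integral>\<^sup>+x. 1\<^sup>2 \<partial>M)"
      by (rule Cauchy_Schwarz_nn_integral) measurable
    then have fin: "(\<integral>\<^sup>+x. h x \<partial>M) \<noteq> \<infinity>"
      using False by (auto simp: emeasure_space_1 top_unique)
    define \<phi> :: "'a \<Rightarrow> real" where "\<phi> x = 1 - t * \<kappa> * indicator U x + t * indicator V x" for x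
    have [measurable]: "\<phi> \<in> borel_measurable M" unfolding \<phi>_def by measurable
    have \<phi>0: "\<phi> x \<ge> 0" for x
      using t0 tk kp by (auto simp: \<phi>_def indicator_def)
    have pw: "h x * ennreal (\<phi> x) + ennreal (t * \<kappa>) * (h x * indicator U x) = h x + ennreal t * (h x * indicator V x)" for x
    proof -
      have "ennreal (\<phi> x) + ennreal (t * \<kappa>) * indicator U x = 1 + ennreal t * indicator V x"
      proof -
        have "ennreal (\<phi> x + t * \<kappa> * indicator U x) = ennreal (1 + t * indicator V x)"
          by (simp add: \<phi>_def)
        then show ?thesis
          using \<phi>0[of x] t0 kp by (simp add: ennreal_plus ennreal_mult ennreal_indicator)
      qed
      from arg_cong[OF this, of "\<lambda>y. h x * y"] show ?thesis
        by (simp add: distrib_left mult_ac)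
    qed
    have "(\<integral>\<^sup>+x. h x * ennreal (\<phi> x) \<partial>M) + ennreal (t * \<kappa>) * (\<integral>\<^sup>+x\<in>U. h x \<partial>M)
      = (\<integral>\<^sup>+x. h x * ennreal (\<phi> x) + ennreal (t * \<kappa>) * (h x * indicator U x) \<partial>M)"
      by (subst nn_integral_add) (simp_all add: nn_integral_cmult)
    also have "\<dots> = (\<integral>\<^sup>+x. h x + ennreal t * (h x * indicator V x) \<partial>M)"
      by (simp only: pw)
    also have "\<dots> = (\<integral>\<^sup>+x. h x \<partial>M) + ennreal t * (\<integral>\<^sup>+x\<in>V. h x \<partial>M)"
      by (subst nn_integral_add) (simp_all add: nn_integral_cmult)
    also have "\<dots> = (\<integral>\<^sup>+x. h x \<partial>M) + ennreal (t * \<kappa>) * (\<integral>\<^sup>+x\<in>U. h x \<partial>M)"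
      unfolding int using t0 kp by (simp add: ennreal_mult mult.assoc)
    finally have eq: "(\<integral>\<^sup>+x. h x * ennreal (\<phi> x) \<partial>M) + ennreal (t * \<kappa>) * (\<integral>\<^sup>+x\<in>U. h x \<partial>M)
       = (\<integral>\<^sup>+x. h x \<partial>M) + ennreal (t * \<kappa>) * (\<integral>\<^sup>+x\<in>U. h x \<partial>M)" .
    have "(\<integral>\<^sup>+x\<in>U. h x \<partial>M) \<le> (\<integral>\<^sup>+x. h x \<partial>M)"
      by (intro nn_integral_mono) (auto simp: indicator_def)
    then have "ennreal (t * \<kappa>) * (\<integral>\<^sup>+x\<in>U. h x \<partial>M) \<noteq> \<infinity>"
      using fin by (auto simp: ennreal_mult_eq_top_iff top_unique)
    with eq have eq: "(\<integral>\<^sup>+x. h x * ennreal (\<phi> x) \<partial>M) = (\<integral>\<^sup>+x. h x \<partial>M)"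
      by (metis ennreal_add_left_cancel infinity_ennreal_def add.commute)
    have phi2: "(\<phi> x)\<^sup>2 \<le> 1 + (t\<^sup>2 * \<kappa>\<^sup>2 - 2 * t * \<kappa>) * indicator U x + (t\<^sup>2 + 2 * t) * indicator V x" for x
      using t0 kp unfolding \<phi>_def
      by (auto simp: indicator_def power2_eq_square algebra_simps)
    let ?g = "\<lambda>x. 1 + (t\<^sup>2 * \<kappa>\<^sup>2 - 2 * t * \<kappa>) * indicator U x + (t\<^sup>2 + 2 * t) * indicator V x"
    have ig: "integrable M ?g"
      by (intro Bochner_Integration.integrable_add integrable_mult_right finite_measure.integrable_const)
        (auto simp: emeasure_eq_measure finite_measure_axioms)
    have iphi: "integrable M (\<lambda>x. (\<phi> x)\<^sup>2)"
    proof (rule Bochner_Integration.integrable_bound[OF ig])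
      show "AE x in M. norm ((\<phi> x)\<^sup>2) \<le> norm (?g x)"
        using phi2 by (intro AE_I2) (simp only: real_norm_def, metis abs_ge_self abs_of_nonneg order_trans zero_le_power2)
    qed measurable
    have "integral\<^sup>L M (\<lambda>x. (\<phi> x)\<^sup>2) \<le> integral\<^sup>L M ?g"
      using iphi ig phi2 by (rule integral_mono)
    also have "\<dots> = 1 + (t\<^sup>2 * \<kappa>\<^sup>2 - 2 * t * \<kappa>) * measure M U + (t\<^sup>2 + 2 * t) * measure M V"
      by (simp add: emeasure_eq_measure prob_space)
    also have "\<dots> = 1 + measure M U * (t\<^sup>2 * (\<kappa>\<^sup>2 + \<mu>) - 2 * t * (\<kappa> - \<mu>))"
      by (simp add: muV algebra_simps power2_eq_square)
    also have "t\<^sup>2 * (\<kappa>\<^sup>2 + \<mu>) = t * (\<kappa> - \<mu>)"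
      using den by (simp add: t_def power2_eq_square)
    also have "1 + measure M U * (t * (\<kappa> - \<mu>) - 2 * t * (\<kappa> - \<mu>)) = c"
      by (simp add: c_def t_def power2_eq_square algebra_simps)
    finally have "integral\<^sup>L M (\<lambda>x. (\<phi> x)\<^sup>2) \<le> c" .
    moreover have "(\<integral>\<^sup>+x. (ennreal (\<phi> x))\<^sup>2 \<partial>M) = ennreal (integral\<^sup>L M (\<lambda>x. (\<phi> x)\<^sup>2))"
      using \<phi>0 iphi by (simp add: nn_integral_eq_integral ennreal_power)
    ultimately have "(\<integral>\<^sup>+x. (ennreal (\<phi> x))\<^sup>2 \<partial>M) \<le> ennreal c"
      by (simp add: ennreal_leI)
    moreover have "(\<integral>\<^sup>+x. h x * ennreal (\<phi> x) \<partial>M)\<^sup>2 \<le> (\<integral>\<^sup>+x. (h x)\<^sup>2 \<partial>M) * (\<integral>\<^sup>+x. (ennreal (\<phi> x))\<^sup>2 \<partial>M)"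
      by (rule Cauchy_Schwarz_nn_integral) measurable
    ultimately have "(\<integral>\<^sup>+x. h x * ennreal (\<phi> x) \<partial>M)\<^sup>2 \<le> (\<integral>\<^sup>+x. (h x)\<^sup>2 \<partial>M) * ennreal c"
      by (meson order_trans mult_left_mono zero_le)
    then show ?thesis
      unfolding eq c_def by (simp add: mult.commute)
  qed
qed

section \<open>Averages over one random factor\<close>

lemma matrix_diagonal_mult:
  fixes M :: "real^'n^'m"
  shows "(M ** diagonal_matrix f) $ i $ j = M $ i $ j * f j"
  by (simp add: matrix_matrix_mult_def diagonal_matrix_def if_distrib cong: if_cong)

text \<open>
The stretch by \<open>1 + s\<close> in the direction of \<open>v\<close>, which fixes everything orthogonal to \<open>v\<close>.
\<close>

lemma rank_one_perturbation:
  fixes v :: "real^'n"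
  assumes v: "norm v = 1"
  defines "R \<equiv> (\<lambda>s. (\<chi> i j. (if i = j then 1 else 0) + s * v $ i * v $ j) :: real^'n^'n)"
  shows "det (R s) = 1 + s" and "v \<bullet> x = 0 \<Longrightarrow> R s *v x = x"
    and "(M ** R s) $ i $ j = M $ i $ j + s * (M *v v) $ i * v $ j"
proof -
  fix k :: 'n
  obtain T where T: "orthogonal_matrix T" "T *v axis k 1 = v"
    using orthogonal_matrix_exists_basis[OF v] by blast
  let ?D = "diagonal_matrix (\<lambda>i. if i = k then 1 + s else 1)"
  have Tv: "T $ i $ k = v $ i" for i
    unfolding T(2)[symmetric] by (simp add: matrix_vector_mult_def axis_def if_distrib cong: if_cong)
  have TT: "(\<Sum>m\<in>UNIV. T $ i $ m * T $ j $ m) = (if i = j then 1 else 0)" for i j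
    using T(1) unfolding orthogonal_matrix_def
    by (auto simp: vec_eq_iff matrix_matrix_mult_def transpose_def mat_def)
  have "R s = T ** ?D ** transpose T"
  proof -
    have "(T ** ?D ** transpose T) $ i $ j = R s $ i $ j" for i j
    proof -
      have "(T ** ?D ** transpose T) $ i $ j = (\<Sum>m\<in>UNIV. T $ i $ m * (if m = k then 1 + s else 1) * T $ j $ m)"
        by (subst matrix_matrix_mult_def) (simp add: matrix_diagonal_mult transpose_def)
      also have "\<dots> = (\<Sum>m\<in>UNIV. T $ i $ m * T $ j $ m + (if m = k then s * T $ i $ k * T $ j $ k else 0))"
        by (rule sum.cong) (auto simp: algebra_simps)
      also have "\<dots> = R s $ i $ j"
        by (simp add: sum.distrib TT Tv R_def)
      finally show ?thesis .
    qed
    then show ?thesis by (simp add: vec_eq_iff)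
  qed
  moreover have "det ?D = 1 + s"
    by (subst det_diagonal) (auto simp: diagonal_matrix_def)
  moreover have "det T * det T = 1"
    using det_orthogonal_matrix[OF T(1)] by auto
  ultimately show "det (R s) = 1 + s"
    by (simp add: det_mul)
next
  assume "v \<bullet> x = 0"
  then have vx: "(\<Sum>j\<in>UNIV. v $ j * x $ j) = 0" by (simp add: inner_vec_def)
  have "(R s *v x) $ i = x $ i" for i
  proof -
    have "(R s *v x) $ i = (\<Sum>j\<in>UNIV. (if i = j then x $ j else 0) + s * v $ i * (v $ j * x $ j))"
      by (simp add: R_def matrix_vector_mult_def) (rule sum.cong, auto simp: algebra_simps)
    also have "\<dots> = x $ i"
      by (simp add: sum.distrib vx flip: sum_distrib_left)
    finally show ?thesis .
  qed
  then show "R s *v x = x" by (simp add: vec_eq_iff)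
next
  have "(M ** R s) $ i $ j = (\<Sum>m\<in>UNIV. (if m = j then M $ i $ m else 0) + s * v $ j * (M $ i $ m * v $ m))"
    unfolding R_def matrix_matrix_mult_def by (simp, rule sum.cong) (auto simp: algebra_simps)
  then show "(M ** R s) $ i $ j = M $ i $ j + s * (M *v v) $ i * v $ j"
    by (simp add: sum.distrib matrix_vector_mult_def flip: sum_distrib_left)
qed

definition entry_cube :: "real \<Rightarrow> (real^'n^'n) set" where
  "entry_cube r = {X. \<forall>i j. \<bar>X $ i $ j\<bar> \<le> r}"

definition uniform_cube :: "(real^'n^'n) measure" where
  "uniform_cube = uniform_measure lborel (entry_cube 1)"

lemma closed_entry_cube: "closed (entry_cube r :: (real^'n^'n) set)"
proof -
  have "(entry_cube r :: (real^'n^'n) set) = (\<Inter>i. \<Inter>j. {X. \<bar>X $ i $ j\<bar> \<le> r})"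
    by (auto simp: entry_cube_def)
  then show ?thesis
    by (simp only:) (intro closed_INT ballI closed_Collect_le continuous_intros)
qed

lemma entry_cube_measurable [measurable]: "entry_cube r \<in> sets borel"
  by (rule borel_closed[OF closed_entry_cube])

lemma norm_le_entries:
  fixes X :: "real^'n^'n"
  assumes r: "r \<ge> 0" and X: "X \<in> entry_cube r"
  shows "norm X \<le> real CARD('n) * r"
proof -
  have "(norm X)\<^sup>2 = (\<Sum>i\<in>UNIV. \<Sum>j\<in>UNIV. (X $ i $ j)\<^sup>2)"
    by (simp add: norm_vec_def L2_set_def sum_nonneg)
  also have "\<dots> \<le> (\<Sum>i\<in>(UNIV::'n set). \<Sum>j\<in>(UNIV::'n set). r\<^sup>2)"
  proof (intro sum_mono)
    fix i j
    have "\<bar>X $ i $ j\<bar> \<le> \<bar>r\<bar>" using X r by (simp add: entry_cube_def)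
    then show "(X $ i $ j)\<^sup>2 \<le> r\<^sup>2" by (simp only: abs_le_square_iff)
  qed
  also have "\<dots> = (real CARD('n) * r)\<^sup>2" by (simp add: power2_eq_square)
  finally show ?thesis using r by (auto intro: power2_le_imp_le)
qed

lemma compact_entry_cube: "r \<ge> 0 \<Longrightarrow> compact (entry_cube r :: (real^'n^'n) set)"
  unfolding compact_eq_bounded_closed bounded_iff using norm_le_entries closed_entry_cube by blast

lemma emeasure_entry_cube:
  assumes r: "r > 0"
  shows "emeasure lborel (entry_cube r :: (real^'n^'n) set)
    = ennreal (r ^ (CARD('n) * CARD('n))) * emeasure lborel (entry_cube 1 :: (real^'n^'n) set)"
proof -
  have "indicator (entry_cube r) (r *\<^sub>R X) = (indicator (entry_cube 1) X :: ennreal)" for X :: "real^'n^'n"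
    using r by (auto simp: indicator_def entry_cube_def abs_mult)
  then show ?thesis
    using nn_integral_lborel_scale[of "indicator (entry_cube r :: (real^'n^'n) set)" r] r by simp
qed

lemma emeasure_entry_cube_1:
  obtains q where "q > 0" "emeasure lborel (entry_cube 1 :: (real^'n^'n) set) = ennreal q"
proof -
  let ?Q = "entry_cube 1 :: (real^'n^'n) set"
  have "emeasure lborel ?Q < \<infinity>"
    by (rule emeasure_compact_finite) (simp add: compact_entry_cube)
  moreover have "emeasure lborel ?Q > 0"
  proof -
    have "ball 0 1 \<subseteq> ?Q"
    proof
      fix X :: "real^'n^'n" assume X: "X \<in> ball 0 1"
      show "X \<in> ?Q" unfolding entry_cube_def
      proof safe
        fix i j
        have "\<bar>X $ i $ j\<bar> \<le> norm (X $ i)" by (rule component_le_norm_cart)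
        also have "\<dots> \<le> norm X" by (rule Finite_Cartesian_Product.norm_nth_le)
        finally show "\<bar>X $ i $ j\<bar> \<le> 1" using X by simp
      qed
    qed
    then have "emeasure lborel (ball 0 1 :: (real^'n^'n) set) \<le> emeasure lborel ?Q"
      by (rule emeasure_mono) simp
    moreover obtain b where "b > 0" "emeasure lborel (ball (0::real^'n^'n) 1) = ennreal b"
      by (rule unit_ball_finite_positive)
    ultimately show ?thesis by (metis ennreal_less_zero_iff less_le_trans)
  qed
  ultimately show thesis
    using that by (metis ennreal_cases ennreal_less_zero_iff infinity_ennreal_def less_irrefl)
qed

lemma prob_space_uniform_cube: "prob_space (uniform_cube :: (real^'n^'n) measure)"
proof -
  obtain q where "q > 0" "emeasure lborel (entry_cube 1 :: (real^'n^'n) set) = ennreal q"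
    by (rule emeasure_entry_cube_1)
  then show ?thesis
    unfolding uniform_cube_def by (intro prob_space_uniform_measure) auto
qed

lemma sets_uniform_cube [measurable_cong, simp]: "sets uniform_cube = sets borel"
  by (simp add: uniform_cube_def)

lemma continuous_matrix_mult:
  "continuous_on S (\<lambda>p. fst p ** snd p :: real^'n^'n)"
  unfolding matrix_matrix_mult_def by (intro continuous_intros)

lemma matrix_mult_measurable [measurable (raw)]:
  fixes f g :: "'a \<Rightarrow> real^'n^'n"
  assumes [measurable]: "f \<in> borel_measurable N" "g \<in> borel_measurable N"
  shows "(\<lambda>x. f x ** g x) \<in> borel_measurable N"
proof -
  have "(\<lambda>p. fst p ** snd p :: real^'n^'n) \<in> borel_measurable borel"
    by (rule borel_measurable_continuous_onI[OF continuous_matrix_mult])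
  from measurable_compose[OF _ this, of "\<lambda>x. (f x, g x)" N] show ?thesis
    by (simp add: borel_prod[symmetric])
qed

lemma matrix_vector_mult_measurable [measurable (raw)]:
  fixes f :: "'a \<Rightarrow> real^'n^'n" and g :: "'a \<Rightarrow> real^'n"
  assumes [measurable]: "f \<in> borel_measurable N" "g \<in> borel_measurable N"
  shows "(\<lambda>x. f x *v g x) \<in> borel_measurable N"
proof -
  have "(\<lambda>p. fst p *v snd p :: real^'n) \<in> borel_measurable (borel :: ((real^'n^'n) \<times> (real^'n)) measure)"
    unfolding matrix_vector_mult_def
    by (rule borel_measurable_continuous_onI) (intro continuous_intros)
  from measurable_compose[OF _ this, of "\<lambda>x. (f x, g x)" N] show ?thesis
    by (simp add: borel_prod[symmetric])
qed

lemma det_measurable [measurable (raw)]: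
  fixes f :: "'a \<Rightarrow> real^'n^'n"
  assumes [measurable]: "f \<in> borel_measurable N"
  shows "(\<lambda>x. det (f x)) \<in> borel_measurable N"
proof -
  have "(det :: real^'n^'n \<Rightarrow> real) \<in> borel_measurable borel"
    unfolding det_def by (rule borel_measurable_continuous_onI) (intro continuous_intros)
  from measurable_compose[OF assms this] show ?thesis .
qed

text \<open>
The first factor is the probability of the cube of half the size, \<open>s = \<epsilon> / (d + 2)\<close> is the
strength of the stretch for which this smaller cube stays inside the full one, and
\<open>s\<^sup>2 / 27\<close> is a lower bound for the resulting defect in the Cauchy-Schwarz inequality.
\<close>

definition gap :: "'n::finite itself \<Rightarrow> real \<Rightarrow> real" where
  "gap _ \<epsilon> = (1/2) ^ (CARD('n) * CARD('n)) * (\<epsilon> / (real CARD('n) + 2))\<^sup>2 / 27"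

lemma gap_arith:
  fixes s \<mu> :: real
  assumes s: "0 < s" "s \<le> 1" and \<mu>: "\<mu> \<ge> 1"
  defines "\<kappa> \<equiv> sqrt (1 + s) * \<mu>"
  shows "s\<^sup>2 / 27 \<le> (\<kappa> - \<mu>)\<^sup>2 / (\<kappa>\<^sup>2 + \<mu>)"
proof -
  define r where "r = sqrt (1 + s)"
  have r2: "r\<^sup>2 = 1 + s" using s by (simp add: r_def)
  have r1: "r \<ge> 1" using s by (simp add: r_def)
  have "r\<^sup>2 \<le> 2\<^sup>2" using r2 s by simp
  then have r3: "r \<le> 2" by (rule power2_le_imp_le) simp
  have "(r - 1) * (r + 1) = s" using r2 by (simp add: power2_eq_square algebra_simps)
  moreover have "(r - 1) * (r + 1) \<le> (r - 1) * 3" using r1 r3 by (intro mult_left_mono) auto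
  ultimately have rs: "s / 3 \<le> r - 1" by simp
  have "\<kappa>\<^sup>2 + \<mu> \<le> 3 * \<mu>\<^sup>2"
  proof -
    have "\<kappa>\<^sup>2 = (1 + s) * \<mu>\<^sup>2" by (simp add: \<kappa>_def r_def[symmetric] power_mult_distrib r2)
    also have "\<dots> \<le> 2 * \<mu>\<^sup>2" using s by (intro mult_right_mono) auto
    finally have "\<kappa>\<^sup>2 \<le> 2 * \<mu>\<^sup>2" .
    moreover have "\<mu> * 1 \<le> \<mu> * \<mu>" using \<mu> by (intro mult_left_mono) auto
    ultimately show ?thesis by (simp add: power2_eq_square)
  qed
  have "s\<^sup>2 / 27 = ((s / 3) * \<mu>)\<^sup>2 / (3 * \<mu>\<^sup>2)"
    using \<mu> by (simp add: power2_eq_square field_simps)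
  also have "\<dots> \<le> (\<kappa> - \<mu>)\<^sup>2 / (3 * \<mu>\<^sup>2)"
  proof -
    have "(s / 3) * \<mu> \<le> (r - 1) * \<mu>" using rs \<mu> by (intro mult_right_mono) auto
    also have "\<dots> = \<kappa> - \<mu>" by (simp add: \<kappa>_def r_def algebra_simps)
    finally show ?thesis using s \<mu> by (intro divide_right_mono power_mono) auto
  qed
  also have "\<dots> \<le> (\<kappa> - \<mu>)\<^sup>2 / (\<kappa>\<^sup>2 + \<mu>)"
    using \<open>\<kappa>\<^sup>2 + \<mu> \<le> 3 * \<mu>\<^sup>2\<close> \<mu> by (intro divide_left_mono mult_pos_pos) (auto intro: add_nonneg_pos)
  finally show ?thesis .
qed

text \<open>
The reason for the spectral gap. A function \<open>H\<close> that is multiplied by \<open>sqrt \<bar>det R\<bar>\<close> when its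
argument is multiplied by a matrix \<open>R\<close> fixing \<open>x\<close> cannot be close to a constant. For \<open>R\<close> the
stretch by \<open>1 + s\<close> in a direction orthogonal to \<open>x\<close>, and \<open>T\<close> the affine map of the noise that
corresponds to \<open>g \<mapsto> g ** R\<close>, the integrals of \<open>H\<close> over a small cube \<open>U\<close> and over \<open>T ` U\<close> have
the ratio \<open>sqrt (1 + s) * \<mu>\<close>, where \<open>\<mu>\<close> is the Jacobian of \<open>T\<close> and the ratio of the volumes. So
the defect estimate applies.
\<close>

theorem equivariant_mean_square:
  fixes A :: "real^'n^'n" and x :: "real^'n" and H :: "real^'n^'n \<Rightarrow> ennreal"
  assumes dim: "CARD('n) \<ge> 2" and \<epsilon>: "0 < \<epsilon>" "\<epsilon> \<le> 1"
    and A: "\<And>y. norm (A *v y) \<le> norm y"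
    and H [measurable]: "H \<in> borel_measurable borel"
    and equi: "\<And>g R. R *v x = x \<Longrightarrow> H (g ** R) = ennreal (sqrt \<bar>det R\<bar>) * H g"
  shows "(\<integral>\<^sup>+X. H (A + \<epsilon> *\<^sub>R X) \<partial>uniform_cube)\<^sup>2
    \<le> ennreal (1 - gap TYPE('n) \<epsilon>) * (\<integral>\<^sup>+X. (H (A + \<epsilon> *\<^sub>R X))\<^sup>2 \<partial>uniform_cube)"
proof -
  define D :: real where "D = CARD('n)"
  have D: "D \<ge> 2" using dim by (simp add: D_def)
  obtain y where y: "y \<noteq> 0" "orthogonal x y"
    using orthogonal_to_vector_exists[of x] dim by auto
  define v where "v = (1 / norm y) *\<^sub>R y"
  have v: "norm v = 1" "v \<bullet> x = 0"
    using y by (auto simp: v_def orthogonal_def inner_commute)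
  define s where "s = \<epsilon> / (D + 2)"
  have s: "0 < s" "s \<le> 1" using \<epsilon> D by (auto simp: s_def)
  define R :: "real^'n^'n" where "R = (\<chi> i j. (if i = j then 1 else 0) + s * v $ i * v $ j)"
  note R = rank_one_perturbation[OF v(1), where s=s, folded R_def]
  have Rx: "R *v x = x" using R(2) v(2) by blast
  define L where "L X = X ** R" for X :: "real^'n^'n"
  \<comment> \<open>The Jacobian of \<open>L\<close> is at least one because \<open>L\<close> expands.\<close>
  have lin: "linear L"
    by (rule linearI) (simp_all add: L_def vec_eq_iff R(3) matrix_vector_mult_add_rdistrib
        scaleR_matrix_vector_assoc[symmetric] algebra_simps)
  have Lx: "norm X \<le> norm (L X)" for X
  proof -
    define E :: "real^'n^'n" where "E = (\<chi> i j. (X *v v) $ i * v $ j)"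
    have LE: "L X = X + s *\<^sub>R E"
      by (simp add: L_def vec_eq_iff R(3) E_def)
    have "X \<bullet> E = (\<Sum>i\<in>UNIV. (X *v v) $ i * (X *v v) $ i)"
      by (simp add: inner_vec_def E_def matrix_vector_mult_def sum_distrib_left sum_distrib_right mult_ac)
    also have "\<dots> \<ge> 0" by (intro sum_nonneg) auto
    finally have XE: "X \<bullet> E \<ge> 0" .
    have "(norm (L X))\<^sup>2 = (norm X)\<^sup>2 + 2 * s * (X \<bullet> E) + s\<^sup>2 * (norm E)\<^sup>2"
      unfolding LE power2_norm_eq_inner by (simp add: inner_simps inner_commute power2_eq_square algebra_simps)
    then have "(norm X)\<^sup>2 \<le> (norm (L X))\<^sup>2" using XE s by simp
    then show ?thesis by (rule power2_le_imp_le) simp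
  qed
  obtain \<mu> :: real where \<mu>: "\<mu> \<ge> 1"
    "\<And>h. h \<in> borel_measurable borel \<Longrightarrow> (\<integral>\<^sup>+X. h X \<partial>lborel) = ennreal \<mu> * (\<integral>\<^sup>+X. h (L X) \<partial>lborel)"
    using expanding_change_of_variables[OF lin Lx] by metis
  define b where "b = (1 / \<epsilon>) *\<^sub>R (A ** R - A)"
  define T where "T X = b + L X" for X
  have [measurable]: "L \<in> borel_measurable borel" by (rule linear_measurable[OF lin])
  then have Tm [measurable]: "T \<in> borel_measurable borel" unfolding T_def by measurable
  have T_cov: "(\<integral>\<^sup>+X. h X \<partial>lborel) = ennreal \<mu> * (\<integral>\<^sup>+X. h (T X) \<partial>lborel)"
    if [measurable]: "h \<in> borel_measurable borel" for h :: "real^'n^'n \<Rightarrow> ennreal"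
    unfolding T_def
    by (subst nn_integral_lborel_shift[symmetric, of h b], simp) (rule \<mu>(2), measurable)
  have T_inj: "T X = T Y \<longleftrightarrow> X = Y" for X Y
  proof
    assume "T X = T Y"
    then have "L (X - Y) = 0" by (simp add: T_def linear_diff[OF lin])
    then show "X = Y" using Lx[of "X - Y"] by simp
  qed simp
  \<comment> \<open>The affine map \<open>T\<close> acts on the noise as right multiplication by \<open>R\<close> acts on the factor.\<close>
  have T_mult: "A + \<epsilon> *\<^sub>R T X = (A + \<epsilon> *\<^sub>R X) ** R" for X
  proof -
    have "(A + \<epsilon> *\<^sub>R X) ** R = A ** R + \<epsilon> *\<^sub>R (X ** R)"
      by (simp add: vec_eq_iff R(3) matrix_vector_mult_add_rdistrib
        scaleR_matrix_vector_assoc[symmetric] algebra_simps)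
    then show ?thesis using \<epsilon> by (simp add: T_def L_def b_def scaleR_add_right)
  qed
  define h where "h X = H (A + \<epsilon> *\<^sub>R X)" for X
  have [measurable]: "h \<in> borel_measurable borel" unfolding h_def by measurable
  have hT: "h (T X) = ennreal (sqrt (1 + s)) * h X" for X
    unfolding h_def T_mult using equi[OF Rx] s by (simp add: R(1))
  define U :: "(real^'n^'n) set" where "U = entry_cube (1/2)"
  define V where "V = T ` U"
  have "compact V"
  proof -
    have "continuous_on U T"
      unfolding T_def using lin by (intro continuous_intros linear_continuous_on) (simp add: linear_conv_bounded_linear)
    then show ?thesis unfolding V_def U_def by (intro compact_continuous_image compact_entry_cube) auto
  qed
  then have [measurable]: "V \<in> sets borel" by (rule borel_compact)
  have [measurable]: "U \<in> sets borel" by (simp add: U_def)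
  have UQ: "U \<subseteq> entry_cube 1"
  proof
    fix X assume "X \<in> U"
    then have "\<bar>X $ i $ j\<bar> \<le> 1/2" for i j unfolding U_def entry_cube_def by blast
    then have "\<bar>X $ i $ j\<bar> \<le> 1" for i j using order_trans[of "\<bar>X $ i $ j\<bar>" "1/2" 1] by simp
    then show "X \<in> entry_cube 1" unfolding entry_cube_def by blast
  qed
  \<comment> \<open>Here the size of \<open>s\<close> is used: \<open>T\<close> moves each entry by at most \<open>1 / 2\<close>.\<close>
  have VQ: "V \<subseteq> entry_cube 1"
  proof
    fix Y assume "Y \<in> V"
    then obtain X where X: "X \<in> U" "Y = T X" by (auto simp: V_def)
    let ?g = "A + \<epsilon> *\<^sub>R X"
    have nX: "norm X \<le> D / 2" using norm_le_entries[of "1/2" X] X by (simp add: U_def D_def)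
    have "norm (?g *v v) \<le> norm (A *v v) + \<epsilon> * norm (X *v v)"
      using \<epsilon> norm_triangle_ineq[of "A *v v" "\<epsilon> *\<^sub>R (X *v v)"]
      by (simp add: matrix_vector_mult_add_rdistrib scaleR_matrix_vector_assoc[symmetric])
    also have "\<dots> \<le> 1 + 1 * (D / 2)"
      using A[of v] v(1) norm_matrix_vector_le[of X v] nX \<epsilon> by (intro add_mono mult_mono) auto
    finally have gv: "norm (?g *v v) \<le> (D + 2) / 2" by (simp add: field_simps)
    have "\<bar>Y $ i $ j\<bar> \<le> 1" for i j
    proof -
      have "(A + \<epsilon> *\<^sub>R Y) $ i $ j = ?g $ i $ j + s * (?g *v v) $ i * v $ j"
        unfolding X(2) T_mult by (rule R(3))
      then have "\<epsilon> * Y $ i $ j = \<epsilon> * (X $ i $ j + (?g *v v) $ i * v $ j / (D + 2))"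
        using D by (simp add: s_def field_simps)
      then have Y: "Y $ i $ j = X $ i $ j + (?g *v v) $ i * v $ j / (D + 2)"
        using \<epsilon> by simp
      have "\<bar>(?g *v v) $ i * v $ j\<bar> \<le> ((D + 2) / 2) * 1"
        unfolding abs_mult using gv v(1) component_le_norm_cart[of "?g *v v" i] component_le_norm_cart[of v j] D
        by (intro mult_mono) auto
      then have "\<bar>(?g *v v) $ i * v $ j / (D + 2)\<bar> \<le> 1 / 2"
        using D by (simp add: field_simps)
      moreover have "\<bar>X $ i $ j\<bar> \<le> 1 / 2" using X(1) by (simp add: U_def entry_cube_def)
      ultimately show ?thesis unfolding Y by linarith
    qed
    then show "Y \<in> entry_cube 1" by (simp add: entry_cube_def)
  qed
  obtain q where q: "q > 0" "emeasure lborel (entry_cube 1 :: (real^'n^'n) set) = ennreal q"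
    by (rule emeasure_entry_cube_1)
  let ?W = "uniform_cube :: (real^'n^'n) measure"
  interpret prob_space ?W by (rule prob_space_uniform_cube)
  have int: "(\<integral>\<^sup>+X\<in>S. k X \<partial>?W) = (\<integral>\<^sup>+X\<in>S. k X \<partial>lborel) / ennreal q"
    if "S \<subseteq> entry_cube 1" and [measurable]: "S \<in> sets borel" "k \<in> borel_measurable borel" for S k
  proof -
    have "k X * indicator S X * indicator (entry_cube 1) X = k X * indicator S X" for X
      using that(1) by (auto simp: indicator_def)
    then show ?thesis
      unfolding uniform_cube_def by (subst nn_integral_uniform_measure) (simp_all add: q(2))
  qed
  have covUV: "(\<integral>\<^sup>+X\<in>V. k X \<partial>?W) = ennreal \<mu> * (\<integral>\<^sup>+X\<in>U. k (T X) \<partial>?W)"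
    if [measurable]: "k \<in> borel_measurable borel" for k
  proof -
    have "indicator V (T X) = (indicator U X :: ennreal)" for X
      using T_inj by (auto simp: V_def indicator_def)
    then have "(\<integral>\<^sup>+X\<in>V. k X \<partial>lborel) = ennreal \<mu> * (\<integral>\<^sup>+X\<in>U. k (T X) \<partial>lborel)"
      using T_cov[of "\<lambda>X. k X * indicator V X"] by simp
    then show ?thesis
      using UQ VQ by (simp add: int ennreal_times_divide)
  qed
  define \<kappa> where "\<kappa> = sqrt (1 + s) * \<mu>"
  have PU: "measure ?W U = (1/2) ^ (CARD('n) * CARD('n))"
  proof -
    have "emeasure ?W U = emeasure lborel U / ennreal q"
      using int[of U "\<lambda>_. 1"] UQ by simp
    also have "\<dots> = ennreal ((1/2) ^ (CARD('n) * CARD('n)) * q / q)"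
      unfolding U_def using emeasure_entry_cube[where r="1/2" and 'n='n] q
      by (simp add: ennreal_mult[symmetric] divide_ennreal)
    finally show ?thesis using q by (simp add: measure_def)
  qed
  have "(\<integral>\<^sup>+X. h X \<partial>?W)\<^sup>2 \<le> ennreal (1 - measure ?W U * (\<kappa> - \<mu>)\<^sup>2 / (\<kappa>\<^sup>2 + \<mu>)) * (\<integral>\<^sup>+X. (h X)\<^sup>2 \<partial>?W)"
  proof (rule orthogonality_defect)
    show "prob_space ?W" by (rule prob_space_uniform_cube)
    show "measure ?W V = \<mu> * measure ?W U"
    proof -
      have "emeasure ?W V = ennreal \<mu> * emeasure ?W U"
        using covUV[of "\<lambda>_. 1"] by simp
      then show ?thesis
        using \<mu>(1) by (simp add: emeasure_eq_measure ennreal_mult[symmetric])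
    qed
    show "\<mu> < \<kappa>" using s \<mu>(1) by (simp add: \<kappa>_def)
    show "0 < \<mu>" using \<mu>(1) by simp
    show "(\<integral>\<^sup>+X\<in>V. h X \<partial>?W) = ennreal \<kappa> * (\<integral>\<^sup>+X\<in>U. h X \<partial>?W)"
    proof -
      have "(\<integral>\<^sup>+X\<in>V. h X \<partial>?W) = ennreal \<mu> * (\<integral>\<^sup>+X. ennreal (sqrt (1 + s)) * (h X * indicator U X) \<partial>?W)"
        by (subst covUV) (simp_all add: hT mult.assoc)
      also have "\<dots> = ennreal \<mu> * (ennreal (sqrt (1 + s)) * (\<integral>\<^sup>+X\<in>U. h X \<partial>?W))"
        by (subst nn_integral_cmult) simp_all
      finally show ?thesis
        using \<mu>(1) s by (simp add: \<kappa>_def ennreal_mult mult_ac)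
    qed
  qed measurable
  also have "\<dots> \<le> ennreal (1 - gap TYPE('n) \<epsilon>) * (\<integral>\<^sup>+X. (h X)\<^sup>2 \<partial>?W)"
  proof (intro mult_right_mono ennreal_leI diff_left_mono)
    show "gap TYPE('n) \<epsilon> \<le> measure ?W U * (\<kappa> - \<mu>)\<^sup>2 / (\<kappa>\<^sup>2 + \<mu>)"
      using mult_left_mono[OF gap_arith[OF s \<mu>(1), folded \<kappa>_def] measure_nonneg[of ?W U]]
      by (simp only: gap_def PU s_def D_def times_divide_eq_right)
  qed simp
  finally show ?thesis by (simp add: h_def)
qed

section \<open>The law of the noise and almost sure invertibility\<close>

lemma Basis_matrix: "(Basis :: (real^'n^'n) set) = (\<lambda>(i, j). axis i (axis j 1)) ` UNIV"
  by (auto simp: Basis_vec_def)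

lemma inj_matrix_basis: "inj (\<lambda>(i, j). axis i (axis j 1) :: real^'n^'n)"
  by (auto simp: inj_on_def axis_eq_axis)

lemma mem_matrix_box: "X \<in> box l u \<longleftrightarrow> (\<forall>i j. l $ i $ j < X $ i $ j \<and> X $ i $ j < u $ i $ j)"
  for X :: "real^'n^'n"
  by (auto simp: mem_box Basis_matrix inner_axis)

lemma emeasure_cube_Int_box:
  fixes l u :: "real^'n^'n"
  shows "emeasure lborel (entry_cube 1 \<inter> box l u)
    = ennreal (\<Prod>(i, j)\<in>UNIV. max 0 (min (u $ i $ j) 1 - max (l $ i $ j) (-1)))"
proof -
  define l' :: "real^'n^'n" where "l' = (\<chi> i j. max (l $ i $ j) (-1))"
  define u' :: "real^'n^'n" where "u' = (\<chi> i j. min (u $ i $ j) 1)"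
  have "AE X in lborel. \<forall>b\<in>Basis. (X :: real^'n^'n) \<bullet> b \<noteq> 1 \<and> X \<bullet> b \<noteq> -1"
    by (intro AE_finite_allI finite_Basis AE_conjI AE_lborel_inner_neq)
  then have "AE X in lborel. X \<in> entry_cube 1 \<inter> box l u \<longleftrightarrow> X \<in> box l' u'"
  proof eventually_elim
    case (elim X)
    then have "X $ i $ j \<noteq> 1 \<and> X $ i $ j \<noteq> -1" for i j
      by (auto simp: Basis_matrix inner_axis)
    then have "\<bar>X $ i $ j\<bar> \<le> 1 \<longleftrightarrow> -1 < X $ i $ j \<and> X $ i $ j < 1" for i j
      by (metis abs_le_iff less_le minus_le_iff)
    then show ?case
      by (auto simp: entry_cube_def mem_matrix_box l'_def u'_def)
  qed
  then have "emeasure lborel (entry_cube 1 \<inter> box l u) = emeasure lborel (box l' u')"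
    by (intro emeasure_eq_AE) auto
  also have "\<dots> = ennreal (\<Prod>(i, j)\<in>UNIV. max 0 (u' $ i $ j - l' $ i $ j))"
  proof (cases "\<forall>i j. l' $ i $ j \<le> u' $ i $ j")
    case True
    then have "\<forall>b\<in>Basis. l' \<bullet> b \<le> u' \<bullet> b"
      by (auto simp: Basis_matrix inner_axis)
    then have "emeasure lborel (box l' u') = ennreal (\<Prod>b\<in>Basis. (u' - l') \<bullet> b)"
      by (simp add: emeasure_lborel_box_eq)
    also have "(\<Prod>b\<in>Basis. (u' - l') \<bullet> b) = (\<Prod>(i, j)\<in>UNIV. max 0 (u' $ i $ j - l' $ i $ j))"
      unfolding Basis_matrix using True
      by (subst prod.reindex[OF inj_matrix_basis]) (auto intro!: prod.cong simp: inner_axis)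
    finally show ?thesis .
  next
    case False
    then obtain i j where ij: "\<not> l' $ i $ j \<le> u' $ i $ j" by blast
    then have "X \<notin> box l' u'" for X
      unfolding mem_matrix_box by (meson less_imp_le less_trans)
    then have "box l' u' = {}" by blast
    moreover have "(\<Prod>(i, j)\<in>UNIV. max 0 (u' $ i $ j - l' $ i $ j)) = 0"
      using ij by (intro prod_zero bexI[of _ "(i, j)"]) auto
    ultimately show ?thesis by (simp only: emeasure_empty ennreal_0)
  qed
  finally show ?thesis by (simp add: l'_def u'_def)
qed

lemma emeasure_interval_Int:
  fixes l u :: real
  shows "emeasure lborel ({-1..1} \<inter> {l<..<u}) = ennreal (max 0 (min u 1 - max l (-1)))"
proof -
  have "AE x in lborel. x \<noteq> (1::real) \<and> x \<noteq> -1"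
    by (intro AE_conjI AE_lborel_singleton)
  then have "AE x in lborel. x \<in> {-1..1} \<inter> {l<..<u} \<longleftrightarrow> x \<in> {max l (-1)<..<min u 1}"
    by eventually_elim auto
  then have "emeasure lborel ({-1..1} \<inter> {l<..<u}) = emeasure lborel {max l (-1)<..<min u 1}"
    by (intro emeasure_eq_AE) auto
  then show ?thesis
    by (cases "max l (-1) \<le> min u 1") (auto simp: max_def[of 0])
qed

text \<open>
Boxes generate the Borel sets, and on a box both laws are products over the entries.
\<close>

lemma (in prob_space) distr_uniform_entries:
  fixes X :: "'a \<Rightarrow> real^'n^'n"
  assumes [measurable]: "X \<in> borel_measurable M"
    and indep: "indep_vars (\<lambda>_. borel) (\<lambda>(i, j) \<omega>. X \<omega> $ i $ j) UNIV"
    and unif: "\<And>i j. distr M borel (\<lambda>\<omega>. X \<omega> $ i $ j) = uniform_measure lborel {-1..1}"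
  shows "distr M borel X = uniform_cube"
proof -
  define w :: "real \<Rightarrow> real \<Rightarrow> real" where "w l u = max 0 (min u 1 - max l (-1))" for l u
  have w0: "w l u \<ge> 0" for l u by (simp add: w_def)
  obtain q where q: "q > 0" "emeasure lborel (entry_cube 1 :: (real^'n^'n) set) = ennreal q"
    by (rule emeasure_entry_cube_1)
  have q2: "q = (\<Prod>(i::'n, j::'n)\<in>UNIV. 2)"
  proof -
    have "entry_cube 1 \<subseteq> box (\<chi> i j. -2) (\<chi> i j. 2 :: real^'n^'n)"
      by (auto simp: entry_cube_def mem_matrix_box abs_le_iff minus_le_iff) (smt (verit))+
    then have "entry_cube 1 \<inter> box (\<chi> i j. -2) (\<chi> i j. 2) = (entry_cube 1 :: (real^'n^'n) set)" by blast
    then show ?thesis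
      using emeasure_cube_Int_box[of "\<chi> i j. -2" "\<chi> i j. 2 :: real^'n^'n"] q
      by (simp add: split_beta)
  qed
  have box: "emeasure (distr M borel X) (box l u) = emeasure uniform_cube (box l u)" for l u
  proof -
    let ?A = "\<lambda>p. case p of (i, j) \<Rightarrow> {l $ i $ j <..< u $ i $ j}"
    have p: "prob ((\<lambda>\<omega>. X \<omega> $ i $ j) -` {a<..<b} \<inter> space M) = w a b / 2" for i j a b
    proof -
      have "emeasure (distr M borel (\<lambda>\<omega>. X \<omega> $ i $ j)) {a<..<b} = ennreal (w a b / 2)"
        unfolding unif using divide_ennreal[OF w0, of 2 a b] by (simp add: emeasure_interval_Int w_def[symmetric])
      moreover have "(\<lambda>\<omega>. X \<omega> $ i $ j) \<in> borel_measurable M"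
        using indep unfolding indep_vars_def by force
      ultimately show ?thesis
        by (simp add: emeasure_distr emeasure_eq_measure w0)
    qed
    have "X -` box l u \<inter> space M = (\<Inter>p\<in>UNIV. (case p of (i, j) \<Rightarrow> \<lambda>\<omega>. X \<omega> $ i $ j) -` ?A p \<inter> space M)"
      by (auto simp: mem_matrix_box)
    then have "prob (X -` box l u \<inter> space M) = (\<Prod>p\<in>UNIV. prob ((case p of (i, j) \<Rightarrow> \<lambda>\<omega>. X \<omega> $ i $ j) -` ?A p \<inter> space M))"
      using indep_varsD_finite[OF indep, of ?A] by (simp add: split_beta)
    also have "\<dots> = (\<Prod>(i, j)\<in>UNIV. w (l $ i $ j) (u $ i $ j) / 2)"
      by (intro prod.cong) (auto simp: p)
    also have "\<dots> = (\<Prod>(i, j)\<in>UNIV. w (l $ i $ j) (u $ i $ j)) / q"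
      unfolding q2 by (simp add: split_beta prod_dividef)
    finally have 1: "emeasure (distr M borel X) (box l u) = ennreal ((\<Prod>(i, j)\<in>UNIV. w (l $ i $ j) (u $ i $ j)) / q)"
      by (simp add: emeasure_distr emeasure_eq_measure)
    have "emeasure uniform_cube (box l u) = ennreal ((\<Prod>(i, j)\<in>UNIV. w (l $ i $ j) (u $ i $ j)) / q)"
      unfolding uniform_cube_def
      by (subst emeasure_uniform_measure)
        (auto simp: emeasure_cube_Int_box q w_def[symmetric] divide_ennreal w0 prod_nonneg split_beta)
    with 1 show ?thesis by simp
  qed
  interpret D: prob_space "distr M borel X" by (rule prob_space_distr) measurable
  let ?E = "range (\<lambda>(a, b). box a b :: (real^'n^'n) set)"
  let ?A = "\<lambda>n::nat. box (- (real n *\<^sub>R One)) (real n *\<^sub>R One) :: (real^'n^'n) set"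
  show ?thesis
  proof (rule measure_eqI_generator_eq)
    show "Int_stable ?E" by (auto simp: Int_stable_def box_Int_box)
    show "?E \<subseteq> Pow UNIV" "sets (distr M borel X) = sigma_sets UNIV ?E" "sets uniform_cube = sigma_sets UNIV ?E"
      by (simp_all add: borel_eq_box)
    show "range ?A \<subseteq> ?E" "(\<Union>i. ?A i) = UNIV"
      unfolding UN_box_eq_UNIV by auto
    show "emeasure (distr M borel X) (?A i) \<noteq> \<infinity>" for i
      using D.emeasure_finite by simp
    show "emeasure (distr M borel X) Y = emeasure uniform_cube Y" if "Y \<in> ?E" for Y
      using that box by auto
  qed
qed

lemma finite_singular_shifts:
  fixes B :: "real^'n^'n"
  shows "finite {s. det (B + s *\<^sub>R mat 1) = 0}"
proof -
  have eq: "poly (charpoly (- B)) s = det (B + s *\<^sub>R mat 1)" for s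
    unfolding poly_charpoly by (rule arg_cong[of _ _ det]) (simp add: vec_eq_iff mat_def)
  define s where "s = norm B + 1"
  have "det (B + s *\<^sub>R mat 1) \<noteq> 0"
  proof -
    have "x = 0" if "(B + s *\<^sub>R mat 1) *v x = 0" for x
    proof -
      have "B *v x = - (s *\<^sub>R x)"
        using that by (simp add: matrix_vector_mult_add_rdistrib scaleR_matrix_vector_assoc[symmetric] eq_neg_iff_add_eq_0)
      then have "norm (B *v x) = s * norm x"
        by (simp add: s_def)
      with norm_matrix_vector_le[of B x] have "norm x \<le> 0"
        by (simp add: s_def algebra_simps)
      then show ?thesis by simp
    qed
    then show ?thesis
      using matrix_left_invertible_ker[of "B + s *\<^sub>R mat 1"] by (auto simp: invertible_det_nz[symmetric] invertible_left_inverse)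
  qed
  then have "charpoly (- B) \<noteq> 0"
    using eq[of s] by auto
  from poly_roots_finite[OF this] show ?thesis by (simp add: eq)
qed

text \<open>
On every line parallel to the identity matrix there are only finitely many singular matrices.
By translation invariance and Fubini the set of singular matrices is null.
\<close>

lemma AE_lborel_det_nonzero:
  "AE X in lborel. det (A + \<epsilon> *\<^sub>R X :: real^'n^'n) \<noteq> 0" if "\<epsilon> \<noteq> 0"
proof -
  define k :: "real^'n^'n \<Rightarrow> ennreal" where "k X = indicator {X. det (A + \<epsilon> *\<^sub>R X) = 0} X" for X
  have [measurable]: "k \<in> borel_measurable borel" unfolding k_def by measurable
  have "(\<integral>\<^sup>+X. k X \<partial>lborel) = (\<integral>\<^sup>+s. (\<integral>\<^sup>+X. k X \<partial>lborel) * indicator {0..1::real} s \<partial>lborel)"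
    by (simp add: nn_integral_cmult)
  also have "\<dots> = (\<integral>\<^sup>+s. (\<integral>\<^sup>+X. k (s *\<^sub>R mat 1 + X) * indicator {0..1::real} s \<partial>lborel) \<partial>lborel)"
    by (simp add: nn_integral_multc nn_integral_lborel_shift)
  also have "\<dots> = (\<integral>\<^sup>+X. (\<integral>\<^sup>+s. k (s *\<^sub>R mat 1 + X) * indicator {0..1::real} s \<partial>lborel) \<partial>lborel)"
    by (rule lborel_pair.Fubini'[symmetric]) measurable
  also have "\<dots> = (\<integral>\<^sup>+X. 0 \<partial>(lborel :: (real^'n^'n) measure))"
  proof (rule nn_integral_cong)
    fix X :: "real^'n^'n"
    have "{s. det (A + \<epsilon> *\<^sub>R (s *\<^sub>R mat 1 + X)) = 0} \<subseteq> (\<lambda>t. t / \<epsilon>) ` {t. det ((A + \<epsilon> *\<^sub>R X) + t *\<^sub>R mat 1) = 0}"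
    proof
      fix s assume "s \<in> {s. det (A + \<epsilon> *\<^sub>R (s *\<^sub>R mat 1 + X)) = 0}"
      then have "det ((A + \<epsilon> *\<^sub>R X) + (\<epsilon> * s) *\<^sub>R mat 1) = 0"
        by (simp add: scaleR_add_right add_ac)
      then show "s \<in> (\<lambda>t. t / \<epsilon>) ` {t. det ((A + \<epsilon> *\<^sub>R X) + t *\<^sub>R mat 1) = 0}"
        using that by (intro image_eqI[of _ _ "\<epsilon> * s"]) auto
    qed
    then have fin: "finite {s. det (A + \<epsilon> *\<^sub>R (s *\<^sub>R mat 1 + X)) = 0}"
      using finite_singular_shifts finite_subset by blast
    have "AE s in lborel. s \<notin> {s. det (A + \<epsilon> *\<^sub>R (s *\<^sub>R mat 1 + X)) = 0}"
      using finite_imp_null_set_lborel[OF fin] by (rule AE_not_in)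
    then have "(\<integral>\<^sup>+s. k (s *\<^sub>R mat 1 + X) * indicator {0..1::real} s \<partial>lborel) = (\<integral>\<^sup>+s. 0 \<partial>(lborel :: real measure))"
      by (intro nn_integral_cong_AE) (auto simp: k_def elim!: eventually_mono)
    then show "(\<integral>\<^sup>+s. k (s *\<^sub>R mat 1 + X) * indicator {0..1::real} s \<partial>lborel) = 0" by simp
  qed
  finally have "(\<integral>\<^sup>+X. k X \<partial>lborel) = 0" by simp
  then have "AE X in lborel. k X = 0" by (simp add: nn_integral_0_iff_AE)
  then show ?thesis by eventually_elim (auto simp: k_def indicator_def split: if_splits)
qed

lemma AE_uniform_cube_det_nonzero:
  assumes "\<epsilon> \<noteq> 0"
  shows "AE X in uniform_cube. det (A + \<epsilon> *\<^sub>R X :: real^'n^'n) \<noteq> 0"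
proof -
  obtain q where q: "q > 0" "emeasure lborel (entry_cube 1 :: (real^'n^'n) set) = ennreal q"
    by (rule emeasure_entry_cube_1)
  show ?thesis
    unfolding uniform_cube_def
    by (rule AE_uniform_measureI) (use AE_lborel_det_nonzero[OF assms, of A] in \<open>auto elim: eventually_mono\<close>)
qed

section \<open>Contraction along the random product\<close>

lemma matrix_product_measurable:
  fixes f :: "nat \<Rightarrow> 'a \<Rightarrow> real^'n^'n"
  assumes "\<And>k. k \<in> {1..n} \<Longrightarrow> f k \<in> borel_measurable N"
  shows "(\<lambda>\<omega>. matrix_product (\<lambda>k. f k \<omega>) n) \<in> borel_measurable N"
  using assms
proof (induction n)
  case (Suc n)
  have [measurable]: "f (Suc n) \<in> borel_measurable N" using Suc.prems by simp
  have [measurable]: "(\<lambda>\<omega>. matrix_product (\<lambda>k. f k \<omega>) n) \<in> borel_measurable N"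
    using Suc.prems by (intro Suc.IH) auto
  show ?case by simp
qed simp

lemma matrix_product_cong:
  "(\<And>k. k \<in> {1..n} \<Longrightarrow> B k = C k) \<Longrightarrow> matrix_product B n = matrix_product C n"
  by (induction n) auto

text \<open>
For fixed invertible \<open>g\<close> the map sending \<open>F\<close> to \<open>x \<mapsto> sqrt \<bar>det g\<bar> * F (g x)\<close> preserves the norm of
functions of degree \<open>- d / 2\<close>, in the sense of the shell integral. This is its average over
the noise.
\<close>

definition mean_operator :: "real^'n^'n \<Rightarrow> real \<Rightarrow> (real^'n \<Rightarrow> ennreal) \<Rightarrow> real^'n \<Rightarrow> ennreal" where
  "mean_operator A \<epsilon> F x =
    (\<integral>\<^sup>+X. ennreal (sqrt \<bar>det (A + \<epsilon> *\<^sub>R X)\<bar>) * F ((A + \<epsilon> *\<^sub>R X) *v x) \<partial>uniform_cube)"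

lemma mean_operator_measurable [measurable (raw)]:
  fixes F :: "real^'n \<Rightarrow> ennreal"
  assumes [measurable]: "F \<in> borel_measurable borel"
  shows "mean_operator A \<epsilon> F \<in> borel_measurable borel"
proof -
  interpret prob_space "uniform_cube :: (real^'n^'n) measure" by (rule prob_space_uniform_cube)
  show ?thesis
    unfolding mean_operator_def[abs_def] by measurable
qed

lemma mean_operator_homogeneous:
  fixes F :: "real^'n \<Rightarrow> ennreal"
  assumes [measurable]: "F \<in> borel_measurable borel" and F: "homogeneous_of_degree r F"
  shows "homogeneous_of_degree r (mean_operator A \<epsilon> F)"
  unfolding homogeneous_of_degree_def
proof safe
  fix s :: real and x :: "real^'n" assume s: "s > 0"
  have "mean_operator A \<epsilon> F (s *\<^sub>R x) = (\<integral>\<^sup>+X. ennreal (s powr r) * (ennreal (sqrt \<bar>det (A + \<epsilon> *\<^sub>R X)\<bar>) * F ((A + \<epsilon> *\<^sub>R X) *v x)) \<partial>uniform_cube)"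
    unfolding mean_operator_def using F s
    by (intro nn_integral_cong) (simp add: homogeneous_of_degree_def matrix_vector_mult_scaleR mult_ac)
  also have "\<dots> = ennreal (s powr r) * mean_operator A \<epsilon> F x"
    unfolding mean_operator_def by (rule nn_integral_cmult) measurable
  finally show "mean_operator A \<epsilon> F (s *\<^sub>R x) = ennreal (s powr r) * mean_operator A \<epsilon> F x" .
qed

text \<open>
Pointwise in \<open>x\<close> the square of the mean is at most \<open>1 - gap\<close> times the mean of the square, and
the mean of the squares integrates to at most the square of the norm of \<open>F\<close>.
\<close>

theorem mean_operator_contraction:
  fixes F :: "real^'n \<Rightarrow> ennreal" and A :: "real^'n^'n"
  assumes dim: "CARD('n) \<ge> 2" and \<epsilon>: "0 < \<epsilon>" "\<epsilon> \<le> 1"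
    and A: "\<And>y. norm (A *v y) \<le> norm y"
    and F [measurable]: "F \<in> borel_measurable borel"
    and hom: "homogeneous_of_degree (- real CARD('n) / 2) F"
  shows "(\<integral>\<^sup>+x\<in>dyadic_shell. (mean_operator A \<epsilon> F x)\<^sup>2 \<partial>lborel)
    \<le> ennreal (1 - gap TYPE('n) \<epsilon>) * (\<integral>\<^sup>+x\<in>dyadic_shell. (F x)\<^sup>2 \<partial>lborel)"
proof -
  let ?W = "uniform_cube :: (real^'n^'n) measure"
  interpret W: prob_space ?W by (rule prob_space_uniform_cube)
  interpret pair_sigma_finite ?W "lborel :: (real^'n) measure" ..
  let ?c = "ennreal (1 - gap TYPE('n) \<epsilon>)"
  define g where "g X = A + \<epsilon> *\<^sub>R X" for X
  have [measurable]: "g \<in> borel_measurable borel" unfolding g_def by measurable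
  let ?k = "\<lambda>X x. ennreal \<bar>det (g X)\<bar> * (F (g X *v x))\<^sup>2 * indicator dyadic_shell x"
  have sq: "(ennreal (sqrt \<bar>a\<bar>) * b)\<^sup>2 = ennreal \<bar>a\<bar> * b\<^sup>2" for a b
    by (simp add: power_mult_distrib ennreal_power)
  have pw: "(mean_operator A \<epsilon> F x)\<^sup>2 \<le> ?c * (\<integral>\<^sup>+X. ennreal \<bar>det (g X)\<bar> * (F (g X *v x))\<^sup>2 \<partial>?W)" for x
  proof -
    have "(mean_operator A \<epsilon> F x)\<^sup>2 \<le> ?c * (\<integral>\<^sup>+X. (ennreal (sqrt \<bar>det (A + \<epsilon> *\<^sub>R X)\<bar>) * F ((A + \<epsilon> *\<^sub>R X) *v x))\<^sup>2 \<partial>?W)"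
      unfolding mean_operator_def
    proof (rule equivariant_mean_square[OF dim \<epsilon> A, where x = x and H = "\<lambda>g. ennreal (sqrt \<bar>det g\<bar>) * F (g *v x)"])
      show "(\<lambda>g. ennreal (sqrt \<bar>det g\<bar>) * F (g *v x)) \<in> borel_measurable borel" by measurable
      fix g R :: "real^'n^'n" assume "R *v x = x"
      then have "(g ** R) *v x = g *v x" by (metis matrix_vector_mul_assoc)
      then show "ennreal (sqrt \<bar>det (g ** R)\<bar>) * F ((g ** R) *v x) = ennreal (sqrt \<bar>det R\<bar>) * (ennreal (sqrt \<bar>det g\<bar>) * F (g *v x))"
        by (simp add: det_mul abs_mult real_sqrt_mult ennreal_mult mult_ac)
    qed
    then show ?thesis by (simp add: sq g_def)
  qed
  have "(\<integral>\<^sup>+x\<in>dyadic_shell. (mean_operator A \<epsilon> F x)\<^sup>2 \<partial>lborel)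
    \<le> (\<integral>\<^sup>+x. ?c * (\<integral>\<^sup>+X. ?k X x \<partial>?W) \<partial>lborel)"
    by (intro nn_integral_mono) (use pw in \<open>auto simp: indicator_def\<close>)
  also have "\<dots> = ?c * (\<integral>\<^sup>+x. (\<integral>\<^sup>+X. ?k X x \<partial>?W) \<partial>lborel)"
    by (rule nn_integral_cmult) measurable
  also have "(\<integral>\<^sup>+x. (\<integral>\<^sup>+X. ?k X x \<partial>?W) \<partial>lborel) = (\<integral>\<^sup>+X. (\<integral>\<^sup>+x. ?k X x \<partial>lborel) \<partial>?W)"
    by (rule Fubini') measurable
  also have "\<dots> \<le> (\<integral>\<^sup>+X. (\<integral>\<^sup>+x\<in>dyadic_shell. (F x)\<^sup>2 \<partial>lborel) \<partial>?W)"
  proof (rule nn_integral_mono)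
    fix X
    have "homogeneous_of_degree (- real CARD('n)) (\<lambda>x. (F x)\<^sup>2)"
      using hom unfolding homogeneous_of_degree_def
      by (auto simp: power_mult_distrib ennreal_power powr_realpow[symmetric] powr_powr)
    then show "(\<integral>\<^sup>+x. ?k X x \<partial>lborel) \<le> (\<integral>\<^sup>+x\<in>dyadic_shell. (F x)\<^sup>2 \<partial>lborel)"
      by (intro shell_integral_invariant) auto
  qed
  also have "\<dots> = (\<integral>\<^sup>+x\<in>dyadic_shell. (F x)\<^sup>2 \<partial>lborel)"
    by (simp add: W.emeasure_space_1)
  finally show ?thesis
    by (simp add: mult_left_mono)
qed

locale perturbed_matrices = prob_space P for P :: "'w measure" +
  fixes \<Xi> :: "nat \<Rightarrow> 'w \<Rightarrow> real^'n^'n" and A :: "nat \<Rightarrow> real^'n^'n" and \<epsilon> :: real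
  assumes iid: "iid_uniform_matrices P \<Xi>"
    and A_le_1: "\<And>n. n \<ge> 1 \<Longrightarrow> onorm ((*v) (A n)) \<le> 1"
    and \<epsilon>: "0 < \<epsilon>" "\<epsilon> < 1"
    and dim: "CARD('n) \<ge> 2"
begin

definition "factor k \<omega> = A k + \<epsilon> *\<^sub>R \<Xi> k \<omega>"

abbreviation "prod_matrix n \<omega> \<equiv> matrix_product (\<lambda>k. factor k \<omega>) n"

lemma indep_noise: "indep_vars (\<lambda>_. borel) \<Xi> {1..}"
  using iid by (simp add: iid_uniform_matrices_def)

lemma noise_measurable: "n \<ge> 1 \<Longrightarrow> \<Xi> n \<in> borel_measurable P"
  using indep_noise by (auto simp: indep_vars_def)

lemma factor_measurable: "n \<ge> 1 \<Longrightarrow> factor n \<in> borel_measurable P"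
  unfolding factor_def[abs_def] using noise_measurable by measurable

lemma prod_matrix_measurable [measurable]: "prod_matrix n \<in> borel_measurable P"
  by (intro matrix_product_measurable factor_measurable) simp

lemma noise_distr: "n \<ge> 1 \<Longrightarrow> distr P borel (\<Xi> n) = uniform_cube"
  using iid noise_measurable by (intro distr_uniform_entries) (auto simp: iid_uniform_matrices_def)

lemma A_contracts: "n \<ge> 1 \<Longrightarrow> norm (A n *v y) \<le> norm y"
  using onorm[OF matrix_vector_mul_bounded_linear, of "A n" y] A_le_1[of n]
  by (meson mult_left_le_one_le norm_ge_zero onorm_pos_le matrix_vector_mul_bounded_linear order_trans)

lemma AE_factor_invertible: "AE \<omega> in P. \<forall>n\<ge>1. det (factor n \<omega>) \<noteq> 0"
  unfolding AE_all_countable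
proof
  fix n
  show "AE \<omega> in P. n \<ge> 1 \<longrightarrow> det (factor n \<omega>) \<noteq> 0"
  proof (cases "n \<ge> 1")
    case True
    note [measurable] = noise_measurable[OF True]
    have "AE X in distr P borel (\<Xi> n). det (A n + \<epsilon> *\<^sub>R X) \<noteq> 0"
      unfolding noise_distr[OF True] using \<epsilon> by (intro AE_uniform_cube_det_nonzero) simp
    then show ?thesis
      by (subst (asm) AE_distr_iff) (auto simp: factor_def)
  qed simp
qed

lemma prod_matrix_invertible:
  "(\<forall>n\<ge>1. det (factor n \<omega>) \<noteq> 0) \<Longrightarrow> det (prod_matrix n \<omega>) \<noteq> 0"
  by (induction n) (auto simp: det_mul)

text \<open>
The product of the first \<open>n\<close> factors depends on the noise up to time \<open>n\<close> only.
\<close>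

lemma indep_prod_noise: "indep_var borel (prod_matrix n) borel (\<Xi> (Suc n))"
proof -
  let ?f = "\<lambda>f. matrix_product (\<lambda>k. A k + \<epsilon> *\<^sub>R f k) n"
  have "indep_var (PiM {1..n} (\<lambda>_. borel)) (\<lambda>\<omega>. restrict (\<lambda>i. \<Xi> i \<omega>) {1..n})
      (PiM {Suc n} (\<lambda>_. borel)) (\<lambda>\<omega>. restrict (\<lambda>i. \<Xi> i \<omega>) {Suc n})"
    by (rule indep_var_restrict[OF indep_noise]) auto
  then have "indep_var borel (?f \<circ> (\<lambda>\<omega>. restrict (\<lambda>i. \<Xi> i \<omega>) {1..n}))
      borel ((\<lambda>f. f (Suc n)) \<circ> (\<lambda>\<omega>. restrict (\<lambda>i. \<Xi> i \<omega>) {Suc n}))"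
  proof (rule indep_var_compose)
    show "?f \<in> borel_measurable (PiM {1..n} (\<lambda>_. borel))"
    proof (rule matrix_product_measurable)
      fix k assume [measurable]: "k \<in> {1..n}"
      show "(\<lambda>f. A k + \<epsilon> *\<^sub>R f k) \<in> borel_measurable (PiM {1..n} (\<lambda>_. borel))"
        by measurable
    qed
    show "(\<lambda>f. f (Suc n)) \<in> borel_measurable (PiM {Suc n} (\<lambda>_. borel))"
      by measurable
  qed
  also have "?f \<circ> (\<lambda>\<omega>. restrict (\<lambda>i. \<Xi> i \<omega>) {1..n}) = prod_matrix n"
    by (auto simp: fun_eq_iff factor_def intro!: matrix_product_cong)
  also have "(\<lambda>f. f (Suc n)) \<circ> (\<lambda>\<omega>. restrict (\<lambda>i. \<Xi> i \<omega>) {Suc n}) = \<Xi> (Suc n)"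
    by (simp add: fun_eq_iff)
  finally show ?thesis .
qed

definition mean_along :: "nat \<Rightarrow> (real^'n \<Rightarrow> ennreal) \<Rightarrow> real^'n \<Rightarrow> ennreal" where
  "mean_along n F x = (\<integral>\<^sup>+\<omega>. ennreal (sqrt \<bar>det (prod_matrix n \<omega>)\<bar>) * F (prod_matrix n \<omega> *v x) \<partial>P)"

text \<open>
Averaging over the last factor first: conditionally on the first \<open>n\<close> factors it is an
independent random matrix.
\<close>

lemma mean_along_Suc:
  assumes [measurable]: "F \<in> borel_measurable borel"
  shows "mean_along (Suc n) F x = mean_along n (mean_operator (A (Suc n)) \<epsilon> F) x"
proof -
  define \<phi> where "\<phi> = (\<lambda>(N, X). ennreal (sqrt \<bar>det N\<bar>) *
    (ennreal (sqrt \<bar>det (A (Suc n) + \<epsilon> *\<^sub>R X)\<bar>) * F ((A (Suc n) + \<epsilon> *\<^sub>R X) *v (N *v x))))"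
  have \<phi>m: "\<phi> \<in> borel_measurable (borel \<Otimes>\<^sub>M borel)"
    unfolding \<phi>_def by measurable
  note [measurable] = noise_measurable[of "Suc n", simplified]
  interpret W: prob_space "uniform_cube :: (real^'n^'n) measure" by (rule prob_space_uniform_cube)
  have "mean_along (Suc n) F x = (\<integral>\<^sup>+\<omega>. \<phi> (prod_matrix n \<omega>, \<Xi> (Suc n) \<omega>) \<partial>P)"
    unfolding mean_along_def
    by (intro nn_integral_cong)
      (simp add: \<phi>_def factor_def det_mul abs_mult real_sqrt_mult ennreal_mult matrix_vector_mul_assoc mult_ac)
  also have "\<dots> = (\<integral>\<^sup>+z. \<phi> z \<partial>distr P (borel \<Otimes>\<^sub>M borel) (\<lambda>\<omega>. (prod_matrix n \<omega>, \<Xi> (Suc n) \<omega>)))"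
    using \<phi>m by (subst nn_integral_distr) auto
  also have "distr P (borel \<Otimes>\<^sub>M borel) (\<lambda>\<omega>. (prod_matrix n \<omega>, \<Xi> (Suc n) \<omega>))
    = distr P borel (prod_matrix n) \<Otimes>\<^sub>M uniform_cube"
    using indep_prod_noise[of n] noise_distr[of "Suc n"] by (simp add: indep_var_distribution_eq)
  also have "(\<integral>\<^sup>+z. \<phi> z \<partial>(distr P borel (prod_matrix n) \<Otimes>\<^sub>M uniform_cube))
    = (\<integral>\<^sup>+N. \<integral>\<^sup>+X. \<phi> (N, X) \<partial>uniform_cube \<partial>distr P borel (prod_matrix n))"
    by (rule W.nn_integral_fst[symmetric]) (use \<phi>m in \<open>simp cong: measurable_cong_sets sets_pair_measure_cong\<close>)
  also have "\<dots> = (\<integral>\<^sup>+\<omega>. \<integral>\<^sup>+X. \<phi> (prod_matrix n \<omega>, X) \<partial>uniform_cube \<partial>P)"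
    unfolding \<phi>_def by (subst nn_integral_distr) auto
  also have "\<dots> = mean_along n (mean_operator (A (Suc n)) \<epsilon> F) x"
    unfolding mean_along_def mean_operator_def \<phi>_def
    by (intro nn_integral_cong) (simp add: nn_integral_cmult)
  finally show ?thesis .
qed

lemma gap_bounds: "0 < gap TYPE('n) \<epsilon>" "gap TYPE('n) \<epsilon> < 1"
proof -
  show "0 < gap TYPE('n) \<epsilon>" using \<epsilon> by (simp add: gap_def)
  have "\<epsilon> / (real CARD('n) + 2) \<le> 1" using \<epsilon> by simp
  then have "(\<epsilon> / (real CARD('n) + 2))\<^sup>2 \<le> 1" using \<epsilon> by (intro power_le_one) auto
  moreover have "(1/2::real) ^ (CARD('n) * CARD('n)) \<le> 1" by (intro power_le_one) auto
  ultimately have "(1/2) ^ (CARD('n) * CARD('n)) * (\<epsilon> / (real CARD('n) + 2))\<^sup>2 \<le> 1"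
    by (intro mult_le_one) auto
  then show "gap TYPE('n) \<epsilon> < 1" by (simp add: gap_def)
qed

text \<open>
All operators contract the same norm by the same factor, whatever the matrices \<open>A\<close> are, so the
factors multiply along an arbitrary sequence.
\<close>

theorem mean_along_decay:
  assumes "F \<in> borel_measurable borel" "homogeneous_of_degree (- real CARD('n) / 2) F"
  shows "(\<integral>\<^sup>+x\<in>dyadic_shell. (mean_along n F x)\<^sup>2 \<partial>lborel)
    \<le> ennreal ((1 - gap TYPE('n) \<epsilon>) ^ n) * (\<integral>\<^sup>+x\<in>dyadic_shell. (F x)\<^sup>2 \<partial>lborel)"
  using assms
proof (induction n arbitrary: F)
  case 0
  then show ?case by (simp add: mean_along_def emeasure_space_1)
next
  case (Suc n)
  let ?c = "1 - gap TYPE('n) \<epsilon>"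
  let ?F = "mean_operator (A (Suc n)) \<epsilon> F"
  have c: "?c \<ge> 0" using gap_bounds by simp
  have "(\<integral>\<^sup>+x\<in>dyadic_shell. (mean_along (Suc n) F x)\<^sup>2 \<partial>lborel) = (\<integral>\<^sup>+x\<in>dyadic_shell. (mean_along n ?F x)\<^sup>2 \<partial>lborel)"
    using Suc.prems(1) by (simp add: mean_along_Suc)
  also have "\<dots> \<le> ennreal (?c ^ n) * (\<integral>\<^sup>+x\<in>dyadic_shell. (?F x)\<^sup>2 \<partial>lborel)"
    using Suc.prems by (intro Suc.IH mean_operator_measurable mean_operator_homogeneous)
  also have "\<dots> \<le> ennreal (?c ^ n) * (ennreal ?c * (\<integral>\<^sup>+x\<in>dyadic_shell. (F x)\<^sup>2 \<partial>lborel))"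
    using Suc.prems dim \<epsilon> by (intro mult_left_mono mean_operator_contraction A_contracts) auto
  also have "\<dots> = ennreal (?c ^ Suc n) * (\<integral>\<^sup>+x\<in>dyadic_shell. (F x)\<^sup>2 \<partial>lborel)"
    using c by (simp add: ennreal_mult mult_ac)
  finally show ?case .
qed

end

section \<open>Exponential growth of the condition number\<close>

lemma nonsingular_nonzero:
  fixes M :: "real^'n^'n"
  shows "det M \<noteq> 0 \<Longrightarrow> M \<noteq> 0"
proof
  assume "det M \<noteq> 0" "M = 0"
  moreover have "(0 :: real^'n^'n) = mat 0" by (simp add: vec_eq_iff mat_def)
  ultimately show False using det_0[where 'a=real and 'n='n] by simp
qed

text \<open>
In terms of the singular values, \<open>\<bar>det M\<bar>\<close> is at least \<open>s\<^sub>1 * s\<^sub>d ^ (d - 1)\<close> and \<open>norm M\<close> is the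
Frobenius norm, at most \<open>sqrt d * s\<^sub>1\<close>.
\<close>

lemma ln_det_over_norm_lower_bound:
  fixes M :: "real^'n^'n"
  assumes M: "det M \<noteq> 0"
  shows "ln (sqrt \<bar>det M\<bar> * norm M powr (- real CARD('n) / 2))
    \<ge> - ((real CARD('n) - 1) / 2) * ln (condition_number M) - real CARD('n) / 4 * ln (real CARD('n))"
proof -
  define d where "d = real CARD('n)"
  have d: "d \<ge> 1" by (simp add: d_def Suc_leI)
  have sm: "s_min M > 0" by (rule s_min_pos[OF M])
  have sM: "s_max M > 0" using sm s_min_le_s_max[of M] by simp
  have M0: "M \<noteq> 0" using M by (rule nonsingular_nonzero)
  have "ln (s_max M * s_min M ^ (CARD('n) - 1)) \<le> ln \<bar>det M\<bar>"
    using s_max_s_min_det[of M] sm sM M by (intro ln_le_cancel_iff[THEN iffD2]) auto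
  then have 1: "ln (s_max M) + (d - 1) * ln (s_min M) \<le> ln \<bar>det M\<bar>"
    using sm sM by (simp add: ln_mult ln_realpow d_def of_nat_diff Suc_leI)
  have "ln (norm M) \<le> ln (sqrt d * s_max M)"
    using norm_matrix_le_s_max[of M] M0 sM d by (intro ln_le_cancel_iff[THEN iffD2]) (auto simp: d_def)
  also have "\<dots> = ln d / 2 + ln (s_max M)"
    using sM d by (simp add: ln_mult ln_sqrt)
  finally have 2: "d / 2 * ln (norm M) \<le> d / 2 * (ln d / 2 + ln (s_max M))"
    using d by (intro mult_left_mono) auto
  have eq: "ln (sqrt \<bar>det M\<bar> * norm M powr (- d / 2)) = ln \<bar>det M\<bar> / 2 - d / 2 * ln (norm M)"
    using M M0 by (simp add: ln_mult ln_sqrt ln_powr)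
  have k: "ln (condition_number M) = ln (s_max M) - ln (s_min M)"
    using sm sM by (simp add: condition_number_def ln_div)
  have "- ((d - 1) / 2) * (ln (s_max M) - ln (s_min M)) - d / 4 * ln d
      = (ln (s_max M) + (d - 1) * ln (s_min M)) / 2 - d / 2 * (ln d / 2 + ln (s_max M))"
    by (simp add: field_simps)
  also have "\<dots> \<le> ln \<bar>det M\<bar> / 2 - d / 2 * ln (norm M)"
    using 1 2 by (intro diff_mono divide_right_mono) auto
  finally show ?thesis
    unfolding d_def[symmetric] eq k .
qed

lemma dyadic_shell_finite_positive:
  obtains b :: real where "b > 0" "emeasure lborel (dyadic_shell :: 'a::euclidean_space set) = ennreal b"
proof -
  obtain e :: 'a where e: "norm e = 1" by (rule vector_choose_size[of 1]) auto
  have "ball ((3/2) *\<^sub>R e) (1/4) \<subseteq> dyadic_shell"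
  proof
    fix x assume "x \<in> ball ((3/2) *\<^sub>R e) (1/4)"
    then have "norm ((3/2) *\<^sub>R e - x) < 1/4" by (simp add: dist_norm)
    moreover have "norm ((3/2) *\<^sub>R e) = 3/2" using e by simp
    ultimately show "x \<in> dyadic_shell"
      using norm_triangle_ineq2[of "(3/2) *\<^sub>R e" x] norm_triangle_ineq3[of "(3/2) *\<^sub>R e" x]
      by (simp add: dyadic_shell_def)
  qed
  then have "emeasure lborel (ball ((3/2) *\<^sub>R e) (1/4)) \<le> emeasure lborel (dyadic_shell :: 'a set)"
    by (rule emeasure_mono) simp
  moreover have "emeasure lborel (ball ((3/2) *\<^sub>R e) (1/4)) > 0"
    by (simp add: emeasure_ball unit_ball_vol_pos)
  moreover have "emeasure lborel (dyadic_shell :: 'a set) < \<infinity>"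
    by (rule emeasure_bounded_finite) (auto simp: bounded_iff dyadic_shell_def intro!: exI[of _ 2])
  ultimately show thesis
    using that by (metis ennreal_cases ennreal_less_zero_iff infinity_ennreal_def less_irrefl less_le_trans)
qed

context perturbed_matrices
begin

text \<open>
At most \<open>d powr (- d / 4)\<close>, with equality for nonzero multiples of isometries. By the preceding lemma it can be exponentially small only if the condition number
is exponentially large.
\<close>

definition isotropy :: "nat \<Rightarrow> 'w \<Rightarrow> real" where
  "isotropy n \<omega> = sqrt \<bar>det (prod_matrix n \<omega>)\<bar> * norm (prod_matrix n \<omega>) powr (- real CARD('n) / 2)"

lemma isotropy_nonneg: "isotropy n \<omega> \<ge> 0" by (simp add: isotropy_def)

lemma isotropy_measurable [measurable]: "isotropy n \<in> borel_measurable P"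
  unfolding isotropy_def[abs_def] by measurable

text \<open>
The decay estimate for \<open>F y = norm y powr (- d / 2)\<close>. On the shell
\<open>norm (M *v x) \<le> 2 * norm M\<close>, so the mean of the isotropy is a lower bound for \<open>mean_along n F x\<close>,
uniformly in \<open>x\<close>.
\<close>

lemma isotropy_mean_decay:
  "(\<integral>\<^sup>+\<omega>. ennreal (isotropy n \<omega>) \<partial>P) \<le> ennreal (2 powr (real CARD('n) / 2) * exp (- gap TYPE('n) \<epsilon> / 2) ^ n)"
proof -
  define a where "a = real CARD('n) / 2"
  define \<delta> where "\<delta> = gap TYPE('n) \<epsilon>"
  have \<delta>: "0 < \<delta>" "\<delta> < 1" using gap_bounds by (auto simp: \<delta>_def)
  define F :: "real^'n \<Rightarrow> ennreal" where "F y = ennreal (norm y powr - a)" for y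
  have Fm [measurable]: "F \<in> borel_measurable borel" unfolding F_def by measurable
  have Fhom: "homogeneous_of_degree (- real CARD('n) / 2) F"
    unfolding homogeneous_of_degree_def F_def
    by (auto simp: a_def powr_mult ennreal_mult)
  define E where "E = (\<integral>\<^sup>+\<omega>. ennreal (isotropy n \<omega>) \<partial>P)"
  obtain b where b: "b > 0" "emeasure lborel (dyadic_shell :: (real^'n) set) = ennreal b"
    by (rule dyadic_shell_finite_positive)
  let ?e = "ennreal (2 powr - a) * E"
  have lower: "?e \<le> mean_along n F x" if x: "x \<in> dyadic_shell" for x
  proof -
    have "ennreal (2 powr - a) * ennreal (isotropy n \<omega>)
      \<le> ennreal (sqrt \<bar>det (prod_matrix n \<omega>)\<bar>) * F (prod_matrix n \<omega> *v x)" for \<omega>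
    proof (cases "det (prod_matrix n \<omega>) = 0")
      case False
      let ?M = "prod_matrix n \<omega>"
      have "?M *v x \<noteq> 0"
        using nonsingular_kernel[OF False, of x] x by (auto simp: dyadic_shell_def)
      moreover have "norm (?M *v x) \<le> norm ?M * 2"
        using norm_matrix_vector_le[of ?M x] x mult_left_mono[of "norm x" 2 "norm ?M"]
        by (simp add: dyadic_shell_def)
      ultimately have "(norm ?M * 2) powr - a \<le> norm (?M *v x) powr - a"
        by (intro powr_mono2') (auto simp: a_def)
      then have "2 powr - a * isotropy n \<omega> \<le> sqrt \<bar>det ?M\<bar> * norm (?M *v x) powr - a"
        unfolding isotropy_def a_def[symmetric]
        using mult_left_mono[of "(norm ?M * 2) powr - a" "norm (?M *v x) powr - a" "sqrt \<bar>det ?M\<bar>"]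
        by (simp add: powr_mult mult_ac a_def)
      then show ?thesis
        by (simp add: F_def ennreal_mult[symmetric] isotropy_nonneg ennreal_leI)
    qed (simp add: isotropy_def)
    then have "(\<integral>\<^sup>+\<omega>. ennreal (2 powr - a) * ennreal (isotropy n \<omega>) \<partial>P) \<le> mean_along n F x"
      unfolding mean_along_def by (intro nn_integral_mono)
    then show ?thesis by (simp add: E_def nn_integral_cmult)
  qed
  have "?e\<^sup>2 * ennreal b = (\<integral>\<^sup>+x\<in>(dyadic_shell :: (real^'n) set). ?e\<^sup>2 \<partial>lborel)"
    by (simp add: b nn_integral_cmult)
  also have "\<dots> \<le> (\<integral>\<^sup>+x\<in>dyadic_shell. (mean_along n F x)\<^sup>2 \<partial>lborel)"
    using lower by (intro nn_integral_mono) (auto simp: indicator_def intro: power_mono)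
  also have "\<dots> \<le> ennreal ((1 - \<delta>) ^ n) * (\<integral>\<^sup>+x\<in>dyadic_shell. (F x)\<^sup>2 \<partial>lborel)"
    unfolding \<delta>_def by (rule mean_along_decay[OF Fm Fhom])
  also have "(\<integral>\<^sup>+x\<in>dyadic_shell. (F x)\<^sup>2 \<partial>lborel) \<le> (\<integral>\<^sup>+x. indicator dyadic_shell x \<partial>(lborel :: (real^'n) measure))"
  proof (rule nn_integral_mono)
    fix x :: "real^'n"
    have "(F x)\<^sup>2 \<le> 1" if "x \<in> dyadic_shell"
    proof -
      have "norm x powr - a \<le> 1 powr - a"
        using that by (intro powr_mono2') (auto simp: dyadic_shell_def a_def)
      then have "F x \<le> 1" by (simp add: F_def)
      then show ?thesis using power_mono[of "F x" 1 2] by simp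
    qed
    then show "(F x)\<^sup>2 * indicator dyadic_shell x \<le> indicator dyadic_shell x"
      by (auto simp: indicator_def)
  qed
  also have "\<dots> = ennreal b" by (simp add: b)
  finally have "?e\<^sup>2 * ennreal b \<le> ennreal ((1 - \<delta>) ^ n) * ennreal b"
    by (simp add: mult_left_mono)
  then have le: "?e\<^sup>2 \<le> ennreal ((1 - \<delta>) ^ n)"
    using b by (simp add: ennreal_mult_le_mult_iff mult.commute)
  then have "?e \<noteq> \<infinity>"
    by (auto simp: top_unique)
  then obtain r where r: "?e = ennreal r" "r \<ge> 0" by (cases ?e) auto
  have "1 - \<delta> \<le> exp (- \<delta>)" using exp_ge_add_one_self[of "- \<delta>"] by simp
  then have "(1 - \<delta>) ^ n \<le> exp (- \<delta>) ^ n" using \<delta> by (intro power_mono) auto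
  also have "\<dots> = (exp (- \<delta> / 2) ^ n)\<^sup>2"
    by (simp add: exp_of_nat_mult[symmetric] exp_double[symmetric] power_mult[symmetric])
  finally have c: "(1 - \<delta>) ^ n \<le> (exp (- \<delta> / 2) ^ n)\<^sup>2" .
  have "r\<^sup>2 \<le> (1 - \<delta>) ^ n"
    using le r \<delta> by (simp add: ennreal_power)
  from this c have "r\<^sup>2 \<le> (exp (- \<delta> / 2) ^ n)\<^sup>2" by (rule order_trans)
  then have "r \<le> exp (- \<delta> / 2) ^ n" by (rule power2_le_imp_le) simp
  moreover have "E = ennreal (2 powr a) * ?e"
    by (simp add: mult.assoc[symmetric] ennreal_mult[symmetric] powr_add[symmetric])
  ultimately show ?thesis
    unfolding E_def[symmetric] r(1) a_def[symmetric] \<delta>_def[symmetric]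
    using r(2) by (simp add: ennreal_mult[symmetric] mult_left_mono)
qed

text \<open>
Half of the decay rate \<open>gap / 2\<close> of the means is given away to obtain a convergent series of
expectations; the terms of an almost surely convergent series tend to zero.
\<close>

lemma AE_isotropy_exponentially_small:
  "AE \<omega> in P. \<forall>\<^sub>F n in sequentially. isotropy n \<omega> * exp (real n * (gap TYPE('n) \<epsilon> / 4)) \<le> 1"
proof -
  define \<eta> where "\<eta> = gap TYPE('n) \<epsilon> / 4"
  have \<eta>: "\<eta> > 0" using gap_bounds by (simp add: \<eta>_def)
  define C where "C = 2 powr (real CARD('n) / 2)"
  have C: "C \<ge> 0" by (simp add: C_def)
  let ?Y = "\<lambda>n \<omega>. isotropy n \<omega> * exp (real n * \<eta>)"
  have "(\<integral>\<^sup>+\<omega>. ennreal (?Y n \<omega>) \<partial>P) \<le> ennreal (C * exp (- \<eta>) ^ n)" for n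
  proof -
    have "(\<integral>\<^sup>+\<omega>. ennreal (?Y n \<omega>) \<partial>P) = ennreal (exp (real n * \<eta>)) * (\<integral>\<^sup>+\<omega>. ennreal (isotropy n \<omega>) \<partial>P)"
      by (subst nn_integral_cmult[symmetric]) (auto simp: ennreal_mult[symmetric] isotropy_nonneg mult.commute)
    also have "\<dots> \<le> ennreal (exp (real n * \<eta>)) * ennreal (C * exp (- (2 * \<eta>)) ^ n)"
      using isotropy_mean_decay[of n] by (intro mult_left_mono) (simp_all add: C_def \<eta>_def)
    also have "\<dots> = ennreal (C * exp (- \<eta>) ^ n)"
      using C by (simp add: ennreal_mult[symmetric] exp_of_nat_mult[symmetric] exp_add[symmetric] algebra_simps)
    finally show ?thesis .
  qed
  then have "(\<Sum>n. \<integral>\<^sup>+\<omega>. ennreal (?Y n \<omega>) \<partial>P) \<le> (\<Sum>n. ennreal (C * exp (- \<eta>) ^ n))"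
    by (intro suminf_le) auto
  also have "\<dots> < \<infinity>"
  proof -
    have "summable (\<lambda>n. C * exp (- \<eta>) ^ n)"
      using \<eta> by (intro summable_mult summable_geometric) simp
    then show ?thesis
      using C by (subst suminf_ennreal2) auto
  qed
  finally have "(\<integral>\<^sup>+\<omega>. (\<Sum>n. ennreal (?Y n \<omega>)) \<partial>P) \<noteq> \<infinity>"
    by (subst nn_integral_suminf) auto
  then have "AE \<omega> in P. (\<Sum>n. ennreal (?Y n \<omega>)) \<noteq> \<infinity>"
    by (intro nn_integral_PInf_AE) auto
  then show ?thesis
    unfolding \<eta>_def[symmetric]
  proof eventually_elim
    case (elim \<omega>)
    then have "summable (\<lambda>n. ?Y n \<omega>)"
      by (intro summable_suminf_not_top) (auto simp: isotropy_nonneg)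
    then have "(\<lambda>n. ?Y n \<omega>) \<longlonglongrightarrow> 0" by (rule summable_LIMSEQ_zero)
    then have "\<forall>\<^sub>F n in sequentially. ?Y n \<omega> < 1" by (rule order_tendstoD) simp
    then show ?case by (rule eventually_mono) simp
  qed
qed

definition growth :: "'w \<Rightarrow> ereal" where
  "growth \<omega> = liminf (\<lambda>n. ereal (1 / real n * ln (condition_number (prod_matrix n \<omega>))))"

text \<open>
The isotropy decays at the rate \<open>gap / 4\<close>, and up to a constant it is at least the condition
number to the power \<open>- (d - 1) / 2\<close>; dividing the exponents gives the rate.
\<close>

theorem AE_growth_lower_bound:
  "AE \<omega> in P. ereal (gap TYPE('n) \<epsilon> / (2 * (real CARD('n) - 1))) \<le> growth \<omega>"
  using AE_isotropy_exponentially_small AE_factor_invertible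
proof eventually_elim
  case (elim \<omega>)
  define \<eta> where "\<eta> = gap TYPE('n) \<epsilon> / 4"
  define d where "d = real CARD('n)"
  have d: "d \<ge> 2" using dim by (simp add: d_def)
  let ?k = "\<lambda>n. condition_number (prod_matrix n \<omega>)"
  define u where "u n = 2 / (d - 1) * (\<eta> - d / 4 * ln d * (1 / real n))" for n
  have "\<forall>\<^sub>F n in sequentially. ereal (u n) \<le> ereal (1 / real n * ln (?k n))"
    using elim(1)[folded \<eta>_def] eventually_gt_at_top[of 0]
  proof eventually_elim
    case (elim n)
    have inv: "det (prod_matrix n \<omega>) \<noteq> 0"
      using \<open>\<forall>n\<ge>1. det (factor n \<omega>) \<noteq> 0\<close> by (rule prod_matrix_invertible)
    then have "norm (prod_matrix n \<omega>) > 0" using nonsingular_nonzero by simp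
    then have isotropy: "isotropy n \<omega> > 0" using inv by (simp add: isotropy_def)
    have "ln (isotropy n \<omega>) + real n * \<eta> \<le> 0"
      using ln_le_zero_iff[of "isotropy n \<omega> * exp (real n * \<eta>)"] elim(1) isotropy by (simp add: ln_mult)
    moreover have "ln (isotropy n \<omega>) \<ge> - ((d - 1) / 2) * ln (?k n) - d / 4 * ln d"
      unfolding isotropy_def d_def by (rule ln_det_over_norm_lower_bound[OF inv])
    ultimately have "real n * \<eta> - d / 4 * ln d \<le> (d - 1) / 2 * ln (?k n)" by simp
    then have "2 / (d - 1) * (1 / real n) * (real n * \<eta> - d / 4 * ln d)
       \<le> 2 / (d - 1) * (1 / real n) * ((d - 1) / 2 * ln (?k n))"
      using d by (intro mult_left_mono) auto
    also have "\<dots> = 1 / real n * ln (?k n)" using d by simp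
    also have "2 / (d - 1) * (1 / real n) * (real n * \<eta> - d / 4 * ln d) = u n"
      using elim(2) by (simp add: u_def field_simps)
    finally show ?case by simp
  qed
  then have "liminf (\<lambda>n. ereal (u n)) \<le> growth \<omega>"
    unfolding growth_def by (rule Liminf_mono)
  moreover have "u \<longlonglongrightarrow> 2 / (d - 1) * (\<eta> - d / 4 * ln d * 0)"
    unfolding u_def by (intro tendsto_intros lim_1_over_n)
  then have "liminf (\<lambda>n. ereal (u n)) = ereal (2 / (d - 1) * \<eta>)"
    by (intro lim_imp_Liminf) auto
  moreover have "2 / (d - 1) * \<eta> = gap TYPE('n) \<epsilon> / (2 * (d - 1))"
    using d by (simp add: \<eta>_def field_simps)
  ultimately show ?case by (simp add: d_def)
qed

end

section \<open>The zero-one law\<close>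

lemma matrix_product_split:
  "matrix_product B (m + j) = matrix_product (\<lambda>k. B (m + k)) j ** matrix_product B m"
  by (induction j) (auto simp: matrix_mul_assoc)

text \<open>
The constant is the infimum of the rational levels below which the variable stays almost
surely.
\<close>

lemma (in prob_space) AE_constant_ereal:
  fixes X :: "'a \<Rightarrow> ereal"
  assumes [measurable]: "X \<in> borel_measurable M"
    and zero_one: "\<And>r. prob {\<omega> \<in> space M. X \<omega> \<le> r} = 0 \<or> prob {\<omega> \<in> space M. X \<omega> \<le> r} = 1"
  shows "\<exists>C. AE \<omega> in M. X \<omega> = C"
proof -
  let ?S = "range (\<lambda>q::rat. ereal (of_rat q))"
  define T where "T = {r \<in> ?S. prob {\<omega> \<in> space M. X \<omega> \<le> r} = 1}"
  have "AE \<omega> in M. \<forall>r\<in>?S. X \<omega> \<le> r \<longleftrightarrow> r \<in> T"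
  proof (rule AE_ball_countable[THEN iffD2, rule_format])
    show "countable ?S" by simp
    fix r assume r: "r \<in> ?S"
    show "AE \<omega> in M. X \<omega> \<le> r \<longleftrightarrow> r \<in> T"
    proof (cases "r \<in> T")
      case True
      then have "AE \<omega> in M. X \<omega> \<le> r"
        by (subst prob_Collect_eq_1[symmetric]) (auto simp: T_def)
      then show ?thesis using True by simp
    next
      case False
      then have "prob {\<omega> \<in> space M. X \<omega> \<le> r} = 0" using zero_one[of r] r by (auto simp: T_def)
      then have "AE \<omega> in M. \<not> X \<omega> \<le> r"
        by (subst (asm) prob_Collect_eq_0) auto
      then show ?thesis using False by simp
    qed
  qed
  then have "AE \<omega> in M. X \<omega> = Inf T"
  proof eventually_elim
    case (elim \<omega>)
    show ?case
    proof (rule antisym)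
      show "X \<omega> \<le> Inf T"
        using elim by (intro Inf_greatest) (auto simp: T_def)
      show "Inf T \<le> X \<omega>"
      proof (rule ccontr)
        assume "\<not> Inf T \<le> X \<omega>"
        then have less: "X \<omega> < Inf T" by (simp add: not_le)
        obtain q :: rat where q: "X \<omega> < ereal (of_rat q)" "ereal (of_rat q) < Inf T"
          using ereal_dense3[OF less] by (elim exE conjE)
        have "X \<omega> \<le> ereal (of_rat q) \<longleftrightarrow> ereal (of_rat q) \<in> T"
          using elim by (rule bspec) (rule rangeI)
        then have "ereal (of_rat q) \<in> T" using q(1) by (simp only: less_imp_le)
        then have "Inf T \<le> ereal (of_rat q)" by (rule Inf_lower)
        with q show False by simp
      qed
    qed
  qed
  then show ?thesis by blast
qed

context perturbed_matrices
begin

text \<open>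
The first \<open>m\<close> factors are removed from the product, but the normalisation \<open>1 / n\<close> is kept.
\<close>

definition tail_growth :: "nat \<Rightarrow> 'w \<Rightarrow> ereal" where
  "tail_growth m \<omega> = liminf (\<lambda>n. ereal (1 / real n *
     ln (condition_number (matrix_product (\<lambda>k. factor (m + k) \<omega>) (n - m)))))"

text \<open>
The removed factors change the logarithm of the condition number by a bounded amount.
\<close>

lemma tail_growth_eq_growth:
  assumes inv: "\<forall>n\<ge>1. det (factor n \<omega>) \<noteq> 0"
  shows "tail_growth m \<omega> = growth \<omega>"
proof -
  let ?N = "prod_matrix m \<omega>"
  define S where "S n = matrix_product (\<lambda>k. factor (m + k) \<omega>) (n - m)" for n
  define u where "u n = 1 / real n * (ln (condition_number (prod_matrix n \<omega>)) - ln (condition_number (S n)))" for n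
  have N: "det ?N \<noteq> 0" using inv by (rule prod_matrix_invertible)
  have "\<forall>\<^sub>F n in sequentially. norm (u n) \<le> ln (condition_number ?N) * (1 / real n)"
    using eventually_ge_at_top[of m]
  proof eventually_elim
    case (elim n)
    have split: "prod_matrix n \<omega> = S n ** ?N"
      using matrix_product_split[of "\<lambda>k. factor k \<omega>" m "n - m"] elim by (simp add: S_def)
    have M: "det (prod_matrix n \<omega>) \<noteq> 0" using inv by (rule prod_matrix_invertible)
    then have Sn: "det (S n) \<noteq> 0" by (simp add: split det_mul)
    note ge1 = condition_number_ge_1[OF N] condition_number_ge_1[OF M] condition_number_ge_1[OF Sn]
    note le = condition_number_mult[OF Sn N, folded split]
    have "ln (condition_number (prod_matrix n \<omega>)) \<le> ln (condition_number (S n) * condition_number ?N)"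
      using le(1) ge1 by (intro ln_mono) auto
    moreover have "ln (condition_number (S n)) \<le> ln (condition_number (prod_matrix n \<omega>) * condition_number ?N)"
      using le(2) ge1 by (intro ln_mono) auto
    ultimately have "\<bar>ln (condition_number (prod_matrix n \<omega>)) - ln (condition_number (S n))\<bar> \<le> ln (condition_number ?N)"
      using ge1 by (simp add: ln_mult abs_le_iff)
    then have "1 / real n * \<bar>ln (condition_number (prod_matrix n \<omega>)) - ln (condition_number (S n))\<bar> \<le> 1 / real n * ln (condition_number ?N)"
      by (intro mult_left_mono) auto
    then show ?case by (simp add: u_def abs_mult)
  qed
  moreover have "(\<lambda>n. ln (condition_number ?N) * (1 / real n)) \<longlonglongrightarrow> ln (condition_number ?N) * 0"
    by (intro tendsto_intros lim_1_over_n)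
  ultimately have "u \<longlonglongrightarrow> 0"
    by (intro Lim_null_comparison[where f = u]) auto
  then have u0: "(\<lambda>n. ereal (u n)) \<longlonglongrightarrow> 0" by (simp add: zero_ereal_def)
  have "growth \<omega> = liminf (\<lambda>n. ereal (u n) + ereal (1 / real n * ln (condition_number (S n))))"
    unfolding growth_def u_def by (simp add: algebra_simps)
  also have "\<dots> = 0 + tail_growth m \<omega>"
    unfolding tail_growth_def S_def[symmetric] by (rule ereal_liminf_lim_add[OF u0]) simp
  finally show ?thesis by simp
qed

text \<open>
Each \<open>tail_growth m\<close> agrees with \<open>growth\<close> only almost surely; the limit inferior over \<open>m\<close> is a
version of \<open>growth\<close> that depends on no finite set of factors whatsoever, as the zero-one law
requires.
\<close>

definition tail_limit :: "'w \<Rightarrow> ereal" where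
  "tail_limit \<omega> = liminf (\<lambda>m. tail_growth m \<omega>)"

lemma AE_tail_limit_eq_growth: "AE \<omega> in P. tail_limit \<omega> = growth \<omega>"
  using AE_factor_invertible
  by eventually_elim (simp add: tail_limit_def tail_growth_eq_growth Liminf_const)

definition noise_events :: "nat \<Rightarrow> 'w set set" where
  "noise_events i = sigma_sets (space P) {\<Xi> (Suc i) -` B \<inter> space P | B. B \<in> sets borel}"

definition noise_after :: "nat \<Rightarrow> 'w measure" where
  "noise_after m = sigma (space P) (\<Union> (noise_events ` {m..}))"

lemma noise_events_subset: "\<Union> (noise_events ` {m..}) \<subseteq> Pow (space P)"
proof -
  have "sigma_sets (space P) {\<Xi> (Suc i) -` B \<inter> space P | B. B \<in> sets borel} \<subseteq> Pow (space P)" for i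
    by (rule sigma_sets_into_sp[THEN subsetI[where B="Pow (space P)", simplified], rotated]) auto
  then show ?thesis by (auto simp: noise_events_def)
qed

lemma space_noise_after [simp]: "space (noise_after m) = space P"
  unfolding noise_after_def by (rule space_measure_of[OF noise_events_subset])

lemma sets_noise_after: "sets (noise_after m) = sigma_sets (space P) (\<Union> (noise_events ` {m..}))"
  unfolding noise_after_def by (rule sets_measure_of[OF noise_events_subset])

lemma noise_measurable_after:
  assumes "k > m"
  shows "\<Xi> k \<in> borel_measurable (noise_after m)"
proof (rule measurableI)
  fix B :: "(real^'n^'n) set" assume B: "B \<in> sets borel"
  obtain i where i: "k = Suc i" "i \<ge> m" using assms by (cases k) auto
  have "\<Xi> k -` B \<inter> space P \<in> noise_events i"
    unfolding noise_events_def i(1) using B by (intro sigma_sets.Basic) auto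
  then show "\<Xi> k -` B \<inter> space (noise_after m) \<in> sets (noise_after m)"
    unfolding sets_noise_after space_noise_after using i(2) by (intro sigma_sets.Basic) auto
qed simp

lemma tail_growth_measurable_after:
  assumes "m \<le> m'"
  shows "tail_growth m' \<in> borel_measurable (noise_after m)"
proof -
  have [measurable]: "(\<lambda>\<omega>. matrix_product (\<lambda>k. factor (m' + k) \<omega>) j) \<in> borel_measurable (noise_after m)" for j
  proof (rule matrix_product_measurable)
    fix k assume "k \<in> {1..j}"
    then have [measurable]: "\<Xi> (m' + k) \<in> borel_measurable (noise_after m)"
      using assms by (intro noise_measurable_after) auto
    show "factor (m' + k) \<in> borel_measurable (noise_after m)"
      unfolding factor_def[abs_def] by measurable
  qed
  show ?thesis
    unfolding tail_growth_def[abs_def] condition_number_def by measurable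
qed

lemma tail_limit_measurable_after: "tail_limit \<in> borel_measurable (noise_after m)"
proof -
  have "tail_limit = (\<lambda>\<omega>. liminf (\<lambda>k. tail_growth (k + m) \<omega>))"
    unfolding tail_limit_def[abs_def] by (intro ext) (rule liminf_shift_k[symmetric])
  then show ?thesis
    using tail_growth_measurable_after[of m] by simp
qed

text \<open>
The noise is indexed by the positive integers, the events by all natural numbers; hence the
shift by one.
\<close>

lemma indep_noise_events: "indep_sets noise_events UNIV"
proof -
  have ind: "indep_sets (\<lambda>n. sigma_sets (space P) {\<Xi> n -` B \<inter> space P | B. B \<in> sets borel}) {1..}"
    using indep_noise by (simp add: indep_vars_def)
  show ?thesis
    unfolding indep_sets_def
  proof (intro conjI ballI allI impI)
    show "noise_events i \<subseteq> events" for i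
      using ind by (auto simp: indep_sets_def noise_events_def)
    fix J :: "nat set" and E assume J: "J \<noteq> {}" "finite J" and E: "E \<in> Pi J noise_events"
    have "prob (\<Inter>j\<in>Suc ` J. E (j - 1)) = (\<Prod>j\<in>Suc ` J. prob (E (j - 1)))"
      using J E by (intro indep_setsD[OF ind]) (auto simp: noise_events_def)
    then show "prob (\<Inter>j\<in>J. E j) = (\<Prod>j\<in>J. prob (E j))"
      by (simp add: prod.reindex)
  qed
qed

lemma tail_limit_measurable: "tail_limit \<in> borel_measurable P"
proof -
  have "noise_events i \<subseteq> events" for i
    using indep_noise_events by (simp add: indep_sets_def)
  then have "sets (noise_after 0) \<subseteq> sets P"
    unfolding sets_noise_after by (intro sets.sigma_sets_subset) auto
  then show ?thesis
    using tail_limit_measurable_after[of 0] by (auto simp: measurable_def)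
qed

theorem growth_constant: "\<exists>C. AE \<omega> in P. growth \<omega> = C"
proof -
  have "\<exists>C. AE \<omega> in P. tail_limit \<omega> = C"
  proof (rule AE_constant_ereal[OF tail_limit_measurable])
    fix r
    show "prob {\<omega> \<in> space P. tail_limit \<omega> \<le> r} = 0 \<or> prob {\<omega> \<in> space P. tail_limit \<omega> \<le> r} = 1"
    proof (rule kolmogorov_0_1_law[OF _ indep_noise_events])
      show "sigma_algebra (space P) (noise_events i)" for i
        unfolding noise_events_def by (rule sigma_algebra_sigma_sets) auto
      show "{\<omega> \<in> space P. tail_limit \<omega> \<le> r} \<in> tail_events noise_events"
        unfolding tail_events_def
      proof
        fix m
        note [measurable] = tail_limit_measurable_after[of m]
        have "{\<omega> \<in> space (noise_after m). tail_limit \<omega> \<le> r} \<in> sets (noise_after m)" by measurable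
        then show "{\<omega> \<in> space P. tail_limit \<omega> \<le> r} \<in> sigma_sets (space P) (\<Union> (noise_events ` {m..}))"
          by (simp add: sets_noise_after)
      qed
    qed
  qed
  then obtain C where "AE \<omega> in P. tail_limit \<omega> = C" by blast
  with AE_tail_limit_eq_growth have "AE \<omega> in P. growth \<omega> = C" by eventually_elim simp
  then show ?thesis by blast
qed

lemma perturbed_product_eq: "perturbed_product A \<epsilon> (\<lambda>k. \<Xi> k \<omega>) = (\<lambda>n. prod_matrix n \<omega>)"
  by (simp add: perturbed_product_def factor_def fun_eq_iff)

end

section \<open>The lower bound on the growth rate\<close>

lemma quadratic_beats_exp:
  fixes K :: real
  assumes K: "K > 0" and m: "m \<ge> 1"
  shows "\<forall>\<^sub>F \<epsilon> in at_right 0. exp (- 1 / \<epsilon> ^ m) < K * \<epsilon>\<^sup>2"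
proof -
  have "\<forall>\<^sub>F \<epsilon> in at_right 0. exp (- 1 / \<epsilon>) < K * \<epsilon>\<^sup>2"
    using K by real_asymp
  moreover have "\<forall>\<^sub>F \<epsilon> in at_right 0. (\<epsilon>::real) < 1"
    by (rule order_tendstoD[OF tendsto_ident_at]) simp
  moreover have "\<forall>\<^sub>F \<epsilon> in at_right 0. (\<epsilon>::real) > 0"
    by (rule eventually_at_right_less)
  ultimately show ?thesis
  proof eventually_elim
    case (elim \<epsilon>)
    have "\<epsilon> ^ m \<le> \<epsilon> ^ 1" using elim m by (intro power_decreasing) auto
    then have "1 / \<epsilon> \<le> 1 / \<epsilon> ^ m" using elim by (intro divide_left_mono) auto
    then have "exp (- 1 / \<epsilon> ^ m) \<le> exp (- 1 / \<epsilon>)" by simp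
    from this elim(1) show ?case by (rule le_less_trans)
  qed
qed

theorem theorem3:
  assumes "CARD('n::finite) > 3"
  shows "\<exists>c :: real \<Rightarrow> real.
    (\<forall>\<epsilon>\<in>{0<..<1}. c \<epsilon> > 0) \<and>
    (\<forall>\<epsilon>\<in>{0<..<1}. \<forall>(P :: 'w measure) (\<Xi> :: nat \<Rightarrow> 'w \<Rightarrow> real ^ 'n ^ 'n) (A :: nat \<Rightarrow> real ^ 'n ^ 'n).
       iid_uniform_matrices P \<Xi> \<longrightarrow> (\<forall>n\<ge>1. onorm ((*v) (A n)) \<le> 1) \<longrightarrow>
       (\<exists>C :: ereal.
          (AE \<omega> in P.
             liminf (\<lambda>n. ereal (1 / real n *
               ln (singular_value 1 (perturbed_product A \<epsilon> (\<lambda>k. \<Xi> k \<omega>) n) /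
                   singular_value CARD('n) (perturbed_product A \<epsilon> (\<lambda>k. \<Xi> k \<omega>) n)))) = C) \<and>
          ereal (c \<epsilon>) \<le> C)) \<and>
    (\<forall>\<^sub>F \<epsilon> in at_right 0. c \<epsilon> > exp (- 1 / \<epsilon> ^ (16 * CARD('n) + 3)))"
proof (rule exI[of _ "\<lambda>\<epsilon>. gap TYPE('n) \<epsilon> / (2 * (real CARD('n) - 1))"],
    intro conjI ballI allI impI)
  let ?c = "\<lambda>\<epsilon>. gap TYPE('n) \<epsilon> / (2 * (real CARD('n) - 1))"
  define d where "d = real CARD('n)"
  have d: "d > 3" using assms by (simp add: d_def)
  show "?c \<epsilon> > 0" if "\<epsilon> \<in> {0<..<1}" for \<epsilon>
    using that assms by (auto simp: gap_def)
  show "\<forall>\<^sub>F \<epsilon> in at_right 0. ?c \<epsilon> > exp (- 1 / \<epsilon> ^ (16 * CARD('n) + 3))"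
  proof -
    define K where "K = (1/2) ^ (CARD('n) * CARD('n)) / (54 * (d + 2)\<^sup>2 * (d - 1))"
    have "K > 0" using d by (simp add: K_def)
    from quadratic_beats_exp[OF this, of "16 * CARD('n) + 3"]
    have "\<forall>\<^sub>F \<epsilon> in at_right 0. exp (- 1 / \<epsilon> ^ (16 * CARD('n) + 3)) < K * \<epsilon>\<^sup>2" by simp
    moreover have "?c \<epsilon> = K * \<epsilon>\<^sup>2" for \<epsilon>
      by (simp add: gap_def K_def d_def power_divide)
    ultimately show ?thesis by simp
  qed
  fix \<epsilon> :: real and P :: "'w measure" and \<Xi> :: "nat \<Rightarrow> 'w \<Rightarrow> real ^ 'n ^ 'n" and A :: "nat \<Rightarrow> real ^ 'n ^ 'n"
  assume \<epsilon>: "\<epsilon> \<in> {0<..<1}" and iid: "iid_uniform_matrices P \<Xi>" and A: "\<forall>n\<ge>1. onorm ((*v) (A n)) \<le> 1"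
  interpret prob_space P using iid by (simp add: iid_uniform_matrices_def)
  interpret perturbed_matrices P \<Xi> A \<epsilon>
    using \<epsilon> iid A assms by unfold_locales auto
  have growth: "liminf (\<lambda>n. ereal (1 / real n *
      ln (singular_value 1 (perturbed_product A \<epsilon> (\<lambda>k. \<Xi> k \<omega>) n) /
          singular_value CARD('n) (perturbed_product A \<epsilon> (\<lambda>k. \<Xi> k \<omega>) n)))) = growth \<omega>" for \<omega>
    unfolding growth_def condition_number_def s_max_def s_min_def perturbed_product_eq ..
  obtain C where C: "AE \<omega> in P. growth \<omega> = C" using growth_constant by blast
  from C AE_growth_lower_bound have "AE \<omega> in P. ereal (?c \<epsilon>) \<le> C"
    by eventually_elim simp
  then have "ereal (?c \<epsilon>) \<le> C" by simp
  with C show "\<exists>C. (AE \<omega> in P. liminf (\<lambda>n. ereal (1 / real n *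
      ln (singular_value 1 (perturbed_product A \<epsilon> (\<lambda>k. \<Xi> k \<omega>) n) /
          singular_value CARD('n) (perturbed_product A \<epsilon> (\<lambda>k. \<Xi> k \<omega>) n)))) = C) \<and>
      ereal (?c \<epsilon>) \<le> C"
    unfolding growth by blast
qed

end
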